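(* Let $\mathcal H=\mathcal H_n$ be uniformly sparse and let $\mathcal P=\mathcal P_n,\mathcal Q=\mathcal Q_n$ be Rényi-stable. Suppose $D_2(\mathcal P\|\mathcal Q)=(1+o(1))D_{\mathrm{KL}}(\mathcal P\|\mathcal Q)$. Then, in the hidden weighted graph model: 1. If $D_{\mathrm{KL}}(\mathcal P\|\mathcal Q)\ge(1+\eta)\log(p_{1M}^{-1})$ for some constant $\eta>0$, then the maximum likelihood estimator achieves almost exact recovery. 2. If $D_{\mathrm{KL}}(\mathcal P\|\mathcal Q)\le(1-\eta)\log(p_{1M}^{-1})$ for some constant $\eta>0$, then every estimator $\hat H$ (computationally efficient or not) fails to recover any constant fraction of the hidden edges with high probability, i.e. for every constant $\lambda\in(0,1)$, $\Pr[|\hat H\cap H^*|\ge\lambda m]\to0$ as $n\to\infty$.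
   Context: Hidden weighted graph model. For each positive integer $n$, let $K_n$ be the complete graph on $n$ labelled vertices and $N=\binom n2$ its number of edges. $\mathcal H=\mathcal H_n$ is a nonempty collection of subgraphs of $K_n$ (identified with their edge sets), each having exactly $m=m_n$ edges, where $m\to\infty$ as $n\to\infty$. $\mathcal P=\mathcal P_n$ and $\mathcal Q=\mathcal Q_n$ are probability distributions (of edge weights) with $\mathcal P\ll\mathcal Q$. A graph $H^*$ is drawn uniformly at random from $\mathcal H$; conditionally on $H^*$, the weights $A_e$ of the edges $e$ of $K_n$ are independent, with $A_e\sim\mathcal P$ if $e\in H^*$ and $A_e\sim\mathcal Q$ otherwise. An estimator $\hat H$ is a (possibly randomized) function of $A=(A_e)_e$ (it may depend on $\mathcal P,\mathcal Q,\mathcal H$) with values in $\mathcal H$. The maximum likelihood estimator (MLE) outputs a maximizer over $H\in\mathcal H$ of $\sum_{e\in H}\log\frac{d\mathcal P}{d\mathcal Q}(A_e)$. Almost exact recovery: $\hat H$ achieves it if there is a sequence $\delta_n\to0$ with $\Pr[|\hat H\cap H^*|<(1-\delta_n)m]\to0$. $M=|\mathcal H|$ and $p_{1M}=M^{-1/m}$, so $\log M=m\log(p_{1M}^{-1})$; $\log$ is natural, $\log 0=-\infty$. Uniformly sparse: $\log(p_{1M}^{-1})=\omega(1)$ and $$\max_{H_1\in\mathcal H}\ \max_{\ell\in\{0,1,\dots,m\}}\Big\{\log\Pr_{H_2\sim\mathcal H}[|H_1\cap H_2|=\ell]+\ell\log(p_{1M}^{-1})\Big\}=o(\log M),$$ where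 $H_2\sim\mathcal H$ is uniform on $\mathcal H$. Rényi divergence: $D_\alpha(\mathcal P\|\mathcal Q)=\frac1{\alpha-1}\log\mathbb E_{\mathcal P}\big[(\frac{d\mathcal P}{d\mathcal Q})^{\alpha-1}\big]$ for $\alpha\in(0,1)\cup(1,\infty)$, and $D_1=D_{\mathrm{KL}}$. Rényi-stable: both of the following hold. (Upper) For any fixed $\theta>0$ there exists $\alpha_n\in(0,1)$ with $\alpha_n\to1$ and $1-\alpha_n=\omega(1/D_{\mathrm{KL}}(\mathcal P\|\mathcal Q))$ such that $D_{\alpha_n}(\mathcal P\|\mathcal Q)\ge(1-\theta)D_{\mathrm{KL}}(\mathcal P\|\mathcal Q)$ for all sufficiently large $n$. (Lower) For any fixed $\theta>0$ there exists $\beta_n>1$ with $\beta_n\to1$ and $\beta_n-1=\Omega(1/D_{\mathrm{KL}}(\mathcal P\|\mathcal Q))$ such that $D_{\beta_n}(\mathcal P\|\mathcal Q)\le(1+\theta)D_{\mathrm{KL}}(\mathcal P\|\mathcal Q)$ for all sufficiently large $n$. *)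

theory Defs
  imports "HOL-Probability.Probability" "HOL-Library.Landau_Symbols"
begin

definition eln :: "ennreal \<Rightarrow> ereal" where
  "eln x = (if x = 0 then -\<infinity> else if x = \<infinity> then \<infinity> else ereal (ln (enn2real x)))"

text \<open>
  The library's \<^const>\<open>KL_divergence\<close> takes the reference measure first and is a Bochner integral,
  hence \<open>0\<close> if the integrand is not integrable. For \<open>P \<lless> Q\<close> the negative part of
  \<open>log (dP/dQ)\<close> is always \<open>P\<close>-integrable, so in that case the true value is \<open>\<infinity>\<close>.
\<close>
definition kl_div :: "'a measure \<Rightarrow> 'a measure \<Rightarrow> ereal" where
  "kl_div P Q = (if integrable P (entropy_density (exp 1) Q P)
     then ereal (KL_divergence (exp 1) Q P) else \<infinity>)"

text \<open>
  \<^term>\<open>RN_deriv Q P\<close> is \<open>dP/dQ\<close>. The convention \<open>0 powr a = 0\<close> and the value \<open>\<infinity>\<close> of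
  \<^const>\<open>RN_deriv\<close> only matter on a \<open>P\<close>-null set.
\<close>
definition renyi_div :: "real \<Rightarrow> 'a measure \<Rightarrow> 'a measure \<Rightarrow> ereal" where
  "renyi_div \<alpha> P Q = (if \<alpha> = 1 then kl_div P Q
     else ereal (1 / (\<alpha> - 1)) *
       eln (\<integral>\<^sup>+ x. ennreal (enn2real (RN_deriv Q P x) powr (\<alpha> - 1)) \<partial>P))"

text \<open>
  The library's Landau symbols need values in a normed field; these are the same definitions
  for extended reals. They are applied to \<open>1 / D\<close> with \<open>D\<close> in \<open>[0, \<infinity>]\<close>, where \<open>1 / 0 = \<infinity>\<close>
  (over the reals it would be \<open>0\<close>) and \<open>1 / \<infinity> = 0\<close>.
\<close>
definition ereal_smallomega :: "(nat \<Rightarrow> ereal) \<Rightarrow> (nat \<Rightarrow> ereal) \<Rightarrow> bool" where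
  "ereal_smallomega f g \<longleftrightarrow> (\<forall>c>0. \<forall>\<^sub>F n in sequentially. \<bar>f n\<bar> \<ge> ereal c * \<bar>g n\<bar>)"

definition ereal_bigomega :: "(nat \<Rightarrow> ereal) \<Rightarrow> (nat \<Rightarrow> ereal) \<Rightarrow> bool" where
  "ereal_bigomega f g \<longleftrightarrow> (\<exists>c>0. \<forall>\<^sub>F n in sequentially. \<bar>f n\<bar> \<ge> ereal c * \<bar>g n\<bar>)"

definition renyi_stable :: "(nat \<Rightarrow> 'a measure) \<Rightarrow> (nat \<Rightarrow> 'a measure) \<Rightarrow> bool" where
  "renyi_stable P Q \<longleftrightarrow>
     (\<forall>\<theta>>0. \<exists>\<alpha> :: nat \<Rightarrow> real. (\<forall>n. 0 < \<alpha> n \<and> \<alpha> n < 1) \<and> \<alpha> \<longlonglongrightarrow> 1 \<and>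
        ereal_smallomega (\<lambda>n. ereal (1 - \<alpha> n)) (\<lambda>n. 1 / kl_div (P n) (Q n)) \<and>
        (\<forall>\<^sub>F n in sequentially.
           renyi_div (\<alpha> n) (P n) (Q n) \<ge> ereal (1 - \<theta>) * kl_div (P n) (Q n))) \<and>
     (\<forall>\<theta>>0. \<exists>\<beta> :: nat \<Rightarrow> real. (\<forall>n. 1 < \<beta> n) \<and> \<beta> \<longlonglongrightarrow> 1 \<and>
        ereal_bigomega (\<lambda>n. ereal (\<beta> n - 1)) (\<lambda>n. 1 / kl_div (P n) (Q n)) \<and>
        (\<forall>\<^sub>F n in sequentially.
           renyi_div (\<beta> n) (P n) (Q n) \<le> ereal (1 + \<theta>) * kl_div (P n) (Q n)))"

text \<open>A subgraph of the complete graph on \<open>{1..n}\<close> is identified with its set of edges.\<close>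

type_synonym edge = "nat set"
type_synonym graph = "edge set"

definition complete_edges :: "nat \<Rightarrow> edge set" where
  "complete_edges n = {e. e \<subseteq> {1..n} \<and> card e = 2}"

definition p1M :: "graph set \<Rightarrow> nat \<Rightarrow> real" where
  "p1M \<H> m = real (card \<H>) powr (- 1 / real m)"

definition overlap_max :: "graph set \<Rightarrow> nat \<Rightarrow> ereal" where
  "overlap_max \<H> m = (MAX H1\<in>\<H>. MAX l\<in>{0..m}.
     eln (emeasure (uniform_count_measure \<H>) {H2 \<in> \<H>. card (H1 \<inter> H2) = l})
       + ereal (real l * ln (1 / p1M \<H> m)))"

text \<open>
  For \<open>m > 0\<close>, \<^const>\<open>overlap_max\<close> is finite, so \<^const>\<open>real_of_ereal\<close> is harmless: no term is
  \<open>\<infinity>\<close>, and the term \<open>l = m\<close> is \<open>- log |\<H>| + log |\<H>| = 0\<close>.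
\<close>
definition uniformly_sparse :: "(nat \<Rightarrow> graph set) \<Rightarrow> (nat \<Rightarrow> nat) \<Rightarrow> bool" where
  "uniformly_sparse \<H> m \<longleftrightarrow>
     (\<lambda>n. ln (1 / p1M (\<H> n) (m n))) \<in> \<omega>(\<lambda>_. 1) \<and>
     (\<lambda>n. real_of_ereal (overlap_max (\<H> n) (m n))) \<in> o(\<lambda>n. ln (real (card (\<H> n))))"

definition weights_law :: "nat \<Rightarrow> 'a measure \<Rightarrow> 'a measure \<Rightarrow> graph \<Rightarrow> (edge \<Rightarrow> 'a) measure" where
  "weights_law n P Q Hstar = PiM (complete_edges n) (\<lambda>e. if e \<in> Hstar then P else Q)"

text \<open>
  A randomized estimator is a Markov kernel from edge weights to \<open>\<H>\<close>; deterministic estimators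
  are the kernels \<open>\<lambda>A. return (count_space \<H>) (f A)\<close>. When \<open>sets P = sets Q\<close>, all the laws
  \<^term>\<open>weights_law n P Q Hstar\<close> live on the measurable space used here.
\<close>
type_synonym 'a estimator = "(edge \<Rightarrow> 'a) \<Rightarrow> graph measure"

definition is_estimator :: "nat \<Rightarrow> 'a measure \<Rightarrow> graph set \<Rightarrow> 'a estimator \<Rightarrow> bool" where
  "is_estimator n Q \<H> K \<longleftrightarrow>
     K \<in> measurable (PiM (complete_edges n) (\<lambda>_. Q)) (prob_algebra (count_space \<H>))"

definition log_likelihood :: "'a measure \<Rightarrow> 'a measure \<Rightarrow> graph \<Rightarrow> (edge \<Rightarrow> 'a) \<Rightarrow> ereal" where
  "log_likelihood P Q H A = (\<Sum>e\<in>H. eln (RN_deriv Q P (A e)))"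

text \<open>
  Any tie-breaking rule is allowed, including a randomized one. The maximality requirement holds
  almost everywhere, since \<open>dP/dQ\<close> is only determined up to \<open>Q\<close>-null sets.
\<close>
definition is_MLE :: "nat \<Rightarrow> 'a measure \<Rightarrow> 'a measure \<Rightarrow> graph set \<Rightarrow> 'a estimator \<Rightarrow> bool" where
  "is_MLE n P Q \<H> K \<longleftrightarrow> is_estimator n Q \<H> K \<and>
     (AE A in PiM (complete_edges n) (\<lambda>_. Q). AE H in K A.
        \<forall>H'\<in>\<H>. log_likelihood P Q H' A \<le> log_likelihood P Q H A)"

text \<open>The joint law of the hidden graph and the estimate.\<close>
definition recovery_law ::
    "nat \<Rightarrow> 'a measure \<Rightarrow> 'a measure \<Rightarrow> graph set \<Rightarrow> 'a estimator \<Rightarrow> (graph \<times> graph) measure" where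
  "recovery_law n P Q \<H> K =
     do {
       Hstar \<leftarrow> uniform_count_measure \<H>;
       A \<leftarrow> weights_law n P Q Hstar;
       Hhat \<leftarrow> K A;
       return (count_space (\<H> \<times> \<H>)) (Hstar, Hhat)
     }"

definition almost_exact_recovery ::
    "(nat \<Rightarrow> 'a measure) \<Rightarrow> (nat \<Rightarrow> 'a measure) \<Rightarrow> (nat \<Rightarrow> graph set) \<Rightarrow> (nat \<Rightarrow> nat) \<Rightarrow>
      (nat \<Rightarrow> 'a estimator) \<Rightarrow> bool" where
  "almost_exact_recovery P Q \<H> m K \<longleftrightarrow>
     (\<exists>\<delta> :: nat \<Rightarrow> real. \<delta> \<longlonglongrightarrow> 0 \<and>
       (\<lambda>n. measure (recovery_law n (P n) (Q n) (\<H> n) (K n))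
              {(Hstar, Hhat) \<in> \<H> n \<times> \<H> n.
                 real (card (Hhat \<inter> Hstar)) < (1 - \<delta> n) * real (m n)}) \<longlonglongrightarrow> 0)"

end

theory Submission
  imports Defs
begin

text \<open>
  Write \<open>f = dP/dQ\<close>, \<open>L = log (1 / p1M)\<close>, and \<open>lik H A\<close> for the product of \<open>f (A e)\<close> over \<open>e \<in> H\<close>,
  which is the density of the planted law of \<open>H\<close> with respect to the null law \<open>Q\<^sup>E\<close>.

  Recovery. If the estimate misses \<open>k \<ge> \<delta> m\<close> edges of \<open>H\<^sup>*\<close>, then relative to the threshold
  \<open>exp ((1 - \<theta>) D k)\<close> either the likelihood of the \<open>k\<close> missed edges is too small or that of the \<open>k\<close>
  wrong edges is too large. The first is excluded by a union bound over the \<open>2\<^sup>m\<close> subsets of \<open>H\<^sup>*\<close>,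
  because Renyi stability provides the moment \<open>E\<^sub>P (f powr - (1 - \<alpha>))\<close> with \<open>(1 - \<alpha>) D \<longrightarrow> \<infinity>\<close>. The
  second is excluded by Markov's inequality with \<open>E\<^sub>Q f = 1\<close> and the sparsity bound on the number of
  graphs with a given overlap.

  Impossibility. The success probability of an estimator is an expectation under the null law of
  the average \<open>Z\<close> of \<open>lik H\<close> over those \<open>H\<close> that overlap the estimate. By Cauchy-Schwarz, a family of
  graphs that all overlap one fixed graph has many pairs that overlap each other, so \<open>Z\<^sup>2\<close> is bounded
  by the sum of \<open>lik H\<^sub>1 * lik H\<^sub>2\<close> over such pairs. Its null expectation is governed by
  \<open>E\<^sub>Q f\<^sup>2 = exp D\<^sub>2\<close> and tends to \<open>0\<close> when \<open>D\<^sub>2\<close> is below \<open>L\<close> by a constant factor.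
\<close>

subsection \<open>Limits and overlaps\<close>

text \<open>Almost exact recovery asks for one sequence of tolerances tending to 0, whereas the
  error bounds are obtained for each fixed tolerance. A diagonal choice passes from the latter to
  the former.\<close>

lemma diagonal_tendsto_0:
  fixes X :: "nat \<Rightarrow> nat \<Rightarrow> real"
  assumes "\<And>k. X k \<longlonglongrightarrow> 0"
  shows "\<exists>\<kappa> :: nat \<Rightarrow> nat. filterlim \<kappa> at_top sequentially \<and> (\<lambda>n. X (\<kappa> n) n) \<longlonglongrightarrow> 0"
proof -
  have "\<exists>N. \<forall>n\<ge>N. \<bar>X k n\<bar> < 1 / (real k + 1)" for k
    using LIMSEQ_D[OF assms[of k], of "1 / (real k + 1)"] by (auto simp: field_simps)
  then obtain N where N: "\<And>k n. n \<ge> N k \<Longrightarrow> \<bar>X k n\<bar> < 1 / (real k + 1)"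
    by metis
  \<comment> \<open>The level is raised to \<open>k\<close> only once the index has passed the
    threshold \<open>N k\<close>. Capping by \<open>n\<close> makes the set finite, and admitting 0
    unconditionally makes it nonempty.\<close>
  define \<kappa> where "\<kappa> n = Max {k. k \<le> n \<and> (k = 0 \<or> N k \<le> n)}" for n
  have fin: "finite {k. k \<le> n \<and> (k = 0 \<or> N k \<le> n)}" for n by simp
  have mem: "\<kappa> n \<in> {k. k \<le> n \<and> (k = 0 \<or> N k \<le> n)}" for n
    unfolding \<kappa>_def by (rule Max_in[OF fin]) auto
  have ge: "\<kappa> n \<ge> j" if "n \<ge> max (N j) j" for n j
    unfolding \<kappa>_def using that by (intro Max_ge[OF fin]) auto
  have lim: "filterlim \<kappa> at_top sequentially"
    unfolding filterlim_at_top eventually_sequentially using ge by blast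
  have "(\<lambda>n. 1 / (real (\<kappa> n) + 1)) \<longlonglongrightarrow> 0"
    using filterlim_compose[OF LIMSEQ_inverse_real_of_nat lim]
    by (simp add: inverse_eq_divide add.commute)
  moreover have "\<forall>\<^sub>F n in sequentially. norm (X (\<kappa> n) n) \<le> 1 / (real (\<kappa> n) + 1)"
    using filterlim_at_top[THEN iffD1, OF lim, rule_format, of 1]
  proof eventually_elim
    case (elim n)
    with mem[of n] have "N (\<kappa> n) \<le> n" by simp
    from N[OF this] show ?case by simp
  qed
  ultimately have "(\<lambda>n. X (\<kappa> n) n) \<longlonglongrightarrow> 0"
    by (rule Lim_null_comparison[rotated])
  with lim show ?thesis by blast
qed

text \<open>Error terms of both directions have this shape: \<open>m + 1\<close> counts overlap
  sizes, \<open>g\<close> is the sparsity defect and \<open>c\<close> the margin from the threshold.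
  One half of the margin absorbs \<open>g\<close>; the other half beats \<open>m + 1\<close>, since
  \<open>L\<close> diverges.\<close>

lemma sparse_term_tendsto_0:
  fixes m :: "nat \<Rightarrow> nat" and L g :: "nat \<Rightarrow> real"
  assumes m: "filterlim m at_top sequentially" and L: "filterlim L at_top sequentially"
    and g: "g \<in> o(\<lambda>n. real (m n) * L n)" and c: "c > 0"
  shows "(\<lambda>n. (real (m n) + 1) * exp (g n - c * L n * real (m n))) \<longlonglongrightarrow> 0"
proof -
  have "\<forall>\<^sub>F n in sequentially. norm (g n) \<le> (c / 2) * norm (real (m n) * L n)"
    using c by (intro landau_o.smallD[OF g]) auto
  \<comment> \<open>With \<open>4 / c\<close> the remaining half margin is at least
    \<open>2 * m\<close>: one \<open>m\<close> pays for \<open>m + 1 \<le> exp m\<close>, the other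
    leaves the decay \<open>exp (- m)\<close>.\<close>
  moreover have "\<forall>\<^sub>F n in sequentially. L n \<ge> 4 / c"
    using L by (simp add: filterlim_at_top)
  ultimately have "\<forall>\<^sub>F n in sequentially.
      norm ((real (m n) + 1) * exp (g n - c * L n * real (m n))) \<le> exp (- real (m n))"
  proof eventually_elim
    case (elim n)
    have L0: "L n > 0" using elim(2) c by (smt (verit) divide_pos_pos)
    have "g n \<le> (c / 2) * (real (m n) * L n)"
      using elim(1) L0 by (simp add: abs_mult)
    moreover have "4 * real (m n) \<le> c * L n * real (m n)"
      using elim(2) c by (intro mult_right_mono) (auto simp: field_simps)
    ultimately have "real (m n) + (g n - c * L n * real (m n)) \<le> - real (m n)"
      by (simp add: algebra_simps)
    then have "exp (real (m n)) * exp (g n - c * L n * real (m n)) \<le> exp (- real (m n))"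
      by (simp flip: exp_add)
    moreover have "real (m n) + 1 \<le> exp (real (m n))"
      using exp_ge_add_one_self[of "real (m n)"] by (simp only: add.commute)
    ultimately show ?case
      by (smt (verit) exp_ge_zero mult_right_mono norm_mult real_norm_def of_nat_0_le_iff mult_nonneg_nonneg)
  qed
  moreover have "(\<lambda>n. exp (- real (m n))) \<longlonglongrightarrow> 0"
    by (intro filterlim_compose[OF exp_at_bot] filterlim_compose[OF filterlim_uminus_at_bot_at_top]
        filterlim_compose[OF filterlim_real_sequentially m])
  ultimately show ?thesis
    by (rule Lim_null_comparison)
qed

text \<open>Counting weight through the edges of \<open>h\<close> and applying Cauchy-Schwarz bounds
  \<open>r\<^sup>2 * m * W\<^sup>2\<close> by the pair sum weighted with triple overlaps. Pairs of
  small overlap account for at most half of this, so the others carry the rest. The resulting bound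
  no longer depends on \<open>h\<close>, so it can be used for a random estimate.\<close>

lemma weighted_overlap_second_moment:
  fixes w :: "'b set \<Rightarrow> real" and r :: real
  assumes fin: "finite \<H>" and w: "\<And>H. H \<in> \<H> \<Longrightarrow> w H \<ge> 0"
    and card: "\<And>H. H \<in> \<H> \<Longrightarrow> finite H \<and> card H = m" and h: "h \<in> \<H>"
    and m: "m > 0" and r: "r > 0"
  shows "r\<^sup>2 / 2 * (\<Sum>H | H \<in> \<H> \<and> r * m \<le> card (h \<inter> H). w H)\<^sup>2
    \<le> (\<Sum>H1\<in>\<H>. \<Sum>H2 | H2 \<in> \<H> \<and> r\<^sup>2 / 2 * m \<le> card (H1 \<inter> H2). w H1 * w H2)"
proof -
  define S where "S = {H \<in> \<H>. r * m \<le> card (h \<inter> H)}"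
  define W where "W = sum w S"
  have finS: "finite S" using fin by (auto simp: S_def)
  have finh: "finite h" and cardh: "card h = m" using card[OF h] by auto
  have wS: "w H \<ge> 0" if "H \<in> S" for H using that w by (auto simp: S_def)
  have W0: "W \<ge> 0" unfolding W_def by (intro sum_nonneg wS)
  have cnt: "(\<Sum>e\<in>h. of_bool (e \<in> H)) = real (card (h \<inter> H))" for H
    using finh by (simp add: Int_def sum.If_cases of_bool_def)
  have "r * m * W \<le> (\<Sum>H\<in>S. w H * card (h \<inter> H))"
    unfolding W_def sum_distrib_left
    by (intro sum_mono) (use wS in \<open>auto simp: S_def mult.commute intro!: mult_left_mono\<close>)
  also have "\<dots> = (\<Sum>e\<in>h. \<Sum>H\<in>S. w H * of_bool (e \<in> H))"
    unfolding cnt[symmetric] sum_distrib_left by (rule sum.swap)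
  finally have "(r * m * W)\<^sup>2 \<le> (\<Sum>e\<in>h. \<Sum>H\<in>S. w H * of_bool (e \<in> H))\<^sup>2"
    using r W0 by (intro power_mono) auto
  \<comment> \<open>Cauchy-Schwarz over the \<open>m\<close> edges of \<open>h\<close>.\<close>
  also have "\<dots> \<le> (\<Sum>e\<in>h. (\<Sum>H\<in>S. w H * of_bool (e \<in> H))\<^sup>2) * m"
    using sum_squared_le_sum_of_squares[of "\<lambda>e. \<Sum>H\<in>S. w H * of_bool (e \<in> H)" h] cardh by simp
  also have "(\<Sum>e\<in>h. (\<Sum>H\<in>S. w H * of_bool (e \<in> H))\<^sup>2)
      = (\<Sum>e\<in>h. \<Sum>H1\<in>S. \<Sum>H2\<in>S. w H1 * w H2 * of_bool (e \<in> H1 \<inter> H2))"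
    by (simp add: power2_eq_square sum_product of_bool_conj mult_ac)
  also have "\<dots> = (\<Sum>H1\<in>S. \<Sum>H2\<in>S. w H1 * w H2 * card (h \<inter> (H1 \<inter> H2)))"
    unfolding cnt[symmetric] sum_distrib_left
    by (subst sum.swap, rule sum.cong[OF refl], rule sum.swap)
  \<comment> \<open>The triple overlap is below \<open>r\<^sup>2 / 2 * m\<close> for a pair of small
    overlap, and at most \<open>m\<close> for any other pair.\<close>
  also have "\<dots> \<le> (\<Sum>H1\<in>S. \<Sum>H2\<in>S. w H1 * w H2 *
      (r\<^sup>2 / 2 * m + m * of_bool (r\<^sup>2 / 2 * m \<le> card (H1 \<inter> H2))))"
  proof (intro sum_mono mult_left_mono mult_nonneg_nonneg wS)
    fix H1 H2 assume "H1 \<in> S" "H2 \<in> S"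
    then have H1: "finite H1" "card H1 = m" using card by (auto simp: S_def)
    have "card (h \<inter> (H1 \<inter> H2)) \<le> card (H1 \<inter> H2)" "card (H1 \<inter> H2) \<le> m"
      using H1 card_mono[of H1 "H1 \<inter> H2"] by (auto intro!: card_mono)
    then show "real (card (h \<inter> (H1 \<inter> H2)))
        \<le> r\<^sup>2 / 2 * m + m * of_bool (r\<^sup>2 / 2 * m \<le> card (H1 \<inter> H2))"
      by (auto simp: of_bool_def intro: order_trans add_increasing)
  qed
  also have "\<dots> = r\<^sup>2 / 2 * m * W\<^sup>2
      + m * (\<Sum>H1\<in>S. \<Sum>H2\<in>S. w H1 * w H2 * of_bool (r\<^sup>2 / 2 * m \<le> card (H1 \<inter> H2)))"
  proof -
    have "W\<^sup>2 = (\<Sum>H1\<in>S. \<Sum>H2\<in>S. w H1 * w H2)"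
      by (simp only: W_def power2_eq_square sum_product)
    then show ?thesis
      by (simp only: sum_distrib_left sum.distrib[symmetric]) (simp add: algebra_simps)
  qed
  also have "(\<Sum>H1\<in>S. \<Sum>H2\<in>S. w H1 * w H2 * of_bool (r\<^sup>2 / 2 * m \<le> card (H1 \<inter> H2)))
      \<le> (\<Sum>H1\<in>\<H>. \<Sum>H2\<in>\<H>. w H1 * w H2 * of_bool (r\<^sup>2 / 2 * m \<le> card (H1 \<inter> H2)))"
    (is "?l \<le> ?r")
  proof -
    have "S \<subseteq> \<H>" by (auto simp: S_def)
    have "?l \<le> (\<Sum>H1\<in>S. \<Sum>H2\<in>\<H>. w H1 * w H2 * of_bool (r\<^sup>2 / 2 * m \<le> card (H1 \<inter> H2)))"
      using \<open>S \<subseteq> \<H>\<close> w fin wS by (intro sum_mono sum_mono2) auto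
    also have "\<dots> \<le> ?r"
      using \<open>S \<subseteq> \<H>\<close> w fin by (intro sum_mono2 sum_nonneg) auto
    finally show ?thesis .
  qed
  also have "?r = (\<Sum>H1\<in>\<H>. \<Sum>H2 | H2 \<in> \<H> \<and> r\<^sup>2 / 2 * m \<le> card (H1 \<inter> H2). w H1 * w H2)"
    (is "_ = ?T")
    using fin by (intro sum.cong[OF refl])
      (simp add: sum.If_cases of_bool_def if_distrib Int_def cong: if_cong)
  finally have *: "(r * m * W)\<^sup>2 \<le> (r\<^sup>2 / 2 * m * W\<^sup>2 + m * ?T) * m"
    by (auto simp: mult_right_mono mult_left_mono)
  have "(real m)\<^sup>2 * (r\<^sup>2 / 2 * W\<^sup>2) \<le> (real m)\<^sup>2 * ?T"
    using * by (simp add: power2_eq_square algebra_simps)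
  then have "r\<^sup>2 / 2 * W\<^sup>2 \<le> ?T"
    using m by (simp only: mult_le_cancel_left) auto
  then show ?thesis
    by (simp add: W_def S_def)
qed

subsection \<open>Extended logarithms\<close>

lemma eln_eq_ereal:
  assumes "eln x = ereal y" shows "x = ennreal (exp y)"
proof -
  from assms have x: "x \<noteq> 0" "x \<noteq> top" "ln (enn2real x) = y"
    by (auto simp: eln_def split: if_splits)
  then have "0 < enn2real x" by (simp add: enn2real_positive_iff less_top zero_less_iff_neq_zero)
  then have "exp y = enn2real x" using x(3) by auto
  with x(2) show ?thesis by (simp add: less_top)
qed

lemma eln_le_ereal:
  assumes "eln x \<le> ereal y" shows "x \<le> ennreal (exp y)"
proof (cases "eln x")
  case (real z)
  with assms eln_eq_ereal[OF real] show ?thesis by (simp add: ennreal_leI)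
next
  case PInf
  with assms show ?thesis by simp
next
  case MInf
  then have "x = 0" by (auto simp: eln_def split: if_splits)
  then show ?thesis by simp
qed

text \<open>A zero factor gives \<open>-\<infinity>\<close> on both sides. Real arguments never
  produce \<open>\<infinity>\<close>, so no indeterminate sum arises.\<close>

lemma eln_ennreal_mult:
  assumes "x \<ge> 0" "y \<ge> 0"
  shows "eln (ennreal (x * y)) = eln (ennreal x) + eln (ennreal y)"
proof (cases "x = 0 \<or> y = 0")
  case True
  then show ?thesis by (auto simp: eln_def)
next
  case False
  with assms have "x > 0" "y > 0" by auto
  then show ?thesis by (simp add: eln_def ln_mult)
qed

lemma sum_eln_ennreal:
  assumes "\<And>i. i \<in> I \<Longrightarrow> x i \<ge> 0"
  shows "(\<Sum>i\<in>I. eln (ennreal (x i))) = eln (ennreal (\<Prod>i\<in>I. x i))"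
  using assms
proof (induction I rule: infinite_finite_induct)
  case (insert i I)
  then show ?case by (simp add: eln_ennreal_mult prod_nonneg)
qed (auto simp: eln_def one_ereal_def zero_ereal_def)

lemma eln_ennreal_le_imp_le:
  assumes "eln (ennreal x) \<le> eln (ennreal y)" "x > 0"
  shows "x \<le> y"
  using assms by (auto simp: eln_def ennreal_eq_0_iff split: if_splits)

subsection \<open>The model for a fixed number of vertices\<close>

locale hidden_graph =
  fixes n :: nat and m :: nat and \<H> :: "graph set" and P Q :: "'a measure"
  assumes nonempty: "\<H> \<noteq> {}"
    and graphs: "\<And>H. H \<in> \<H> \<Longrightarrow> H \<subseteq> complete_edges n \<and> card H = m"
    and prob_P: "prob_space P" and prob_Q: "prob_space Q"
    and sets_eq: "sets P = sets Q" and ac: "absolutely_continuous Q P"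
begin

abbreviation "E \<equiv> complete_edges n"
abbreviation "QE \<equiv> PiM E (\<lambda>_. Q)"

text \<open>A real-valued version of the density allows products and powers to be taken in the
  reals. It alters \<open>RN_deriv\<close> only where that is infinite, which is a
  \<open>Q\<close>-null set.\<close>

definition f :: "'a \<Rightarrow> real" where "f x = enn2real (RN_deriv Q P x)"

sublocale P: prob_space P by (rule prob_P)
sublocale Q: prob_space Q by (rule prob_Q)

lemma finite_E: "finite E"
proof (rule finite_subset)
  show "E \<subseteq> Pow {1..n}" by (auto simp: complete_edges_def)
qed simp

lemma finite_H: "finite \<H>"
  using finite_subset[of \<H> "Pow E"] graphs finite_E by auto

lemma subset_E: "H \<in> \<H> \<Longrightarrow> H \<subseteq> E" and card_H: "H \<in> \<H> \<Longrightarrow> card H = m"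
  using graphs by auto

lemma finite_graph: "H \<in> \<H> \<Longrightarrow> finite H"
  using subset_E finite_E finite_subset by blast

lemma f_measurable_Q [measurable]: "f \<in> borel_measurable Q"
  unfolding f_def by measurable

lemma f_measurable_P [measurable]: "f \<in> borel_measurable P"
  using f_measurable_Q by (simp add: measurable_cong_sets[OF sets_eq refl])

lemma f_nonneg: "f x \<ge> 0"
  by (simp add: f_def)

lemma AE_RN_deriv: "AE x in Q. RN_deriv Q P x = ennreal (f x)"
proof -
  have "AE x in Q. RN_deriv Q P x \<noteq> \<infinity>"
    by (rule Q.RN_deriv_finite[OF _ ac sets_eq]) unfold_locales
  then show ?thesis
    by eventually_elim (simp add: f_def less_top)
qed

lemma P_density: "P = density Q (\<lambda>x. ennreal (f x))"
proof -
  have "P = density Q (RN_deriv Q P)"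
    using Q.density_RN_deriv[OF ac sets_eq] by simp
  also have "\<dots> = density Q (\<lambda>x. ennreal (f x))"
    using AE_RN_deriv by (intro density_cong) auto
  finally show ?thesis .
qed

lemma AE_f_pos: "AE x in P. f x > 0"
  by (subst P_density) (auto simp: AE_density)

lemma nn_integral_f: "(\<integral>\<^sup>+x. ennreal (f x) \<partial>Q) = 1"
proof -
  have "1 = emeasure P (space P)" by (simp add: P.emeasure_space_1)
  also have "\<dots> = (\<integral>\<^sup>+x. ennreal (f x) * indicator (space P) x \<partial>Q)"
    by (subst P_density) (subst emeasure_density, auto simp: sets_eq[symmetric])
  also have "\<dots> = (\<integral>\<^sup>+x. ennreal (f x) \<partial>Q)"
    using sets_eq_imp_space_eq[OF sets_eq] by (intro nn_integral_cong) auto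
  finally show ?thesis by simp
qed

lemma nn_integral_f_square: "(\<integral>\<^sup>+x. ennreal (f x) * ennreal (f x) \<partial>Q) = (\<integral>\<^sup>+x. ennreal (f x) \<partial>P)"
  by (subst P_density) (subst nn_integral_density, auto)

section \<open>Product laws of the weights and planted likelihoods\<close>

abbreviation "W H \<equiv> weights_law n P Q H"

lemma sets_W: "sets (W H) = sets QE"
  unfolding weights_law_def by (rule sets_PiM_cong) (auto simp: sets_eq)

lemma space_W: "space (W H) = space QE"
  by (rule sets_eq_imp_space_eq[OF sets_W])

lemma product_W: "product_sigma_finite (\<lambda>e. if e \<in> H then P else Q)"
  by (simp add: product_sigma_finite_def P.sigma_finite_measure_axioms Q.sigma_finite_measure_axioms)

lemma prob_space_QE: "prob_space QE"
  by (intro prob_space_PiM prob_Q)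

lemma prob_space_W: "prob_space (W H)"
  unfolding weights_law_def by (intro prob_space_PiM) (auto intro: prob_P prob_Q)

text \<open>Independence of the weights enters here. Edges outside \<open>S\<close> are given the
  factor 1, whose integral is 1 under either probability law.\<close>

lemma nn_integral_W_prod:
  assumes S: "S \<subseteq> E" and g: "\<And>e. e \<in> S \<Longrightarrow> g e \<in> borel_measurable Q"
  shows "(\<integral>\<^sup>+A. (\<Prod>e\<in>S. g e (A e)) \<partial>W H)
    = (\<Prod>e\<in>S. integral\<^sup>N (if e \<in> H then P else Q) (g e))"
proof -
  interpret product_sigma_finite "\<lambda>e. if e \<in> H then P else Q" by (rule product_W)
  let ?g = "\<lambda>e x. if e \<in> S then g e x else 1"
  have "(\<integral>\<^sup>+A. (\<Prod>e\<in>S. g e (A e)) \<partial>W H) = (\<integral>\<^sup>+A. (\<Prod>e\<in>E. ?g e (A e)) \<partial>W H)"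
    using S finite_E
    by (intro nn_integral_cong prod.mono_neutral_cong_left) auto
  also have "\<dots> = (\<Prod>e\<in>E. integral\<^sup>N (if e \<in> H then P else Q) (?g e))"
    unfolding weights_law_def
  proof (rule product_nn_integral_prod[OF finite_E])
    fix e show "?g e \<in> borel_measurable (if e \<in> H then P else Q)"
      using g[of e] by (cases "e \<in> S") (auto simp: measurable_cong_sets[OF sets_eq refl])
  qed
  also have "\<dots> = (\<Prod>e\<in>S. integral\<^sup>N (if e \<in> H then P else Q) (g e))"
    using S finite_E
    by (intro prod.mono_neutral_cong_right) (auto simp: P.emeasure_space_1 Q.emeasure_space_1)
  finally show ?thesis .
qed

lemma nn_integral_QE_prod:
  assumes S: "S \<subseteq> E" and g: "\<And>e. e \<in> S \<Longrightarrow> g e \<in> borel_measurable Q"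
  shows "(\<integral>\<^sup>+A. (\<Prod>e\<in>S. g e (A e)) \<partial>QE) = (\<Prod>e\<in>S. integral\<^sup>N Q (g e))"
  using nn_integral_W_prod[OF assms, where H = "{}"] by (simp only: weights_law_def empty_iff if_False)

definition lik :: "graph \<Rightarrow> (edge \<Rightarrow> 'a) \<Rightarrow> real" where
  "lik H A = (\<Prod>e\<in>H. f (A e))"

lemma lik_nonneg: "lik H A \<ge> 0"
  unfolding lik_def by (intro prod_nonneg) (simp add: f_nonneg)

lemma lik_measurable [measurable]:
  assumes "H \<subseteq> E" shows "lik H \<in> borel_measurable QE"
  unfolding lik_def
proof (rule borel_measurable_prod)
  fix e assume "e \<in> H"
  then have "(\<lambda>A. A e) \<in> measurable QE Q"
    using assms by (intro measurable_component_singleton) auto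
  then show "(\<lambda>A. f (A e)) \<in> borel_measurable QE"
    by (rule measurable_compose[OF _ f_measurable_Q])
qed

text \<open>Finite product measures are determined by rectangles, and on a rectangle the integrand
  factors over the edges. This refers all planted laws to the single null law
  \<open>QE\<close>.\<close>

lemma weights_density:
  assumes H: "H \<subseteq> E"
  shows "W H = density QE (\<lambda>A. ennreal (lik H A))"
  unfolding weights_law_def
proof (rule sym, rule product_sigma_finite.PiM_eqI[OF product_W finite_E])
  show "sets (density QE (\<lambda>A. ennreal (lik H A))) = sets (PiM E (\<lambda>e. if e \<in> H then P else Q))"
    using sets_W[of H] by (simp add: weights_law_def)
next
  fix X assume X: "\<And>e. e \<in> E \<Longrightarrow> X e \<in> sets (if e \<in> H then P else Q)"
  have XQ: "X e \<in> sets Q" if "e \<in> E" for e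
    using X[OF that] by (auto simp: sets_eq split: if_splits)
  have mono: "lik H \<in> borel_measurable QE" using H by (rule lik_measurable)
  have "emeasure (density QE (\<lambda>A. ennreal (lik H A))) (Pi\<^sub>E E X)
      = (\<integral>\<^sup>+A. ennreal (lik H A) * indicator (Pi\<^sub>E E X) A \<partial>QE)"
    using mono XQ finite_E by (intro emeasure_density) (auto intro: sets_PiM_I_finite)
  also have "\<dots> = (\<integral>\<^sup>+A. (\<Prod>e\<in>E. (if e \<in> H then ennreal (f (A e)) else 1) * indicator (X e) (A e)) \<partial>QE)"
  proof (rule nn_integral_cong)
    fix A assume A: "A \<in> space QE"
    have "ennreal (lik H A) = (\<Prod>e\<in>H. ennreal (f (A e)))"
      unfolding lik_def by (rule prod_ennreal[symmetric]) (simp add: f_nonneg)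
    also have "\<dots> = (\<Prod>e\<in>E. if e \<in> H then ennreal (f (A e)) else 1)"
      using H finite_E by (intro prod.mono_neutral_cong_left) auto
    finally have 1: "ennreal (lik H A) = (\<Prod>e\<in>E. if e \<in> H then ennreal (f (A e)) else 1)" .
    have 2: "indicator (Pi\<^sub>E E X) A = (\<Prod>e\<in>E. indicator (X e) (A e) :: ennreal)"
    proof (cases "A \<in> Pi\<^sub>E E X")
      case True then show ?thesis by (auto simp: PiE_iff)
    next
      \<comment> \<open>Points of \<open>space QE\<close> are already extensional, so leaving the
        rectangle means that some coordinate in \<open>E\<close> fails.\<close>
      case False
      with A obtain e where "e \<in> E" "A e \<notin> X e" by (auto simp: space_PiM PiE_iff)
      then have "(\<Prod>e\<in>E. indicator (X e) (A e) :: ennreal) = 0"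
        using finite_E by (intro prod_zero) (auto intro!: bexI[of _ e])
      with False show ?thesis by simp
    qed
    show "ennreal (lik H A) * indicator (Pi\<^sub>E E X) A
        = (\<Prod>e\<in>E. (if e \<in> H then ennreal (f (A e)) else 1) * indicator (X e) (A e))"
      unfolding 1 2 by (simp add: prod.distrib)
  qed
  also have "\<dots> = (\<Prod>e\<in>E. \<integral>\<^sup>+x. (if e \<in> H then ennreal (f x) else 1) * indicator (X e) x \<partial>Q)"
    using XQ by (intro nn_integral_QE_prod) auto
  also have "\<dots> = (\<Prod>e\<in>E. emeasure (if e \<in> H then P else Q) (X e))"
  proof (rule prod.cong[OF refl])
    fix e assume e: "e \<in> E"
    have "emeasure P (X e) = (\<integral>\<^sup>+x. ennreal (f x) * indicator (X e) x \<partial>Q)"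
      using XQ[OF e] by (subst P_density, subst emeasure_density) auto
    then show "(\<integral>\<^sup>+x. (if e \<in> H then ennreal (f x) else 1) * indicator (X e) x \<partial>Q)
        = emeasure (if e \<in> H then P else Q) (X e)"
      using XQ[OF e] by auto
  qed
  finally show "emeasure (density QE (\<lambda>A. ennreal (lik H A))) (Pi\<^sub>E E X)
    = (\<Prod>e\<in>E. emeasure (if e \<in> H then P else Q) (X e))" .
qed

text \<open>The three binds are unfolded one at a time, which requires each stage to be a
  probability kernel.\<close>

lemma emeasure_recovery_law:
  assumes K: "is_estimator n Q \<H> K" and B: "B \<subseteq> \<H> \<times> \<H>"
  shows "emeasure (recovery_law n P Q \<H> K) B
    = (\<Sum>H\<in>\<H>. \<integral>\<^sup>+A. emeasure (K A) {h \<in> \<H>. (H, h) \<in> B} \<partial>W H) / card \<H>"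
proof -
  let ?R = "count_space (\<H> \<times> \<H>)"
  have Kp: "K \<in> measurable (W H) (prob_algebra (count_space \<H>))" for H
    using K unfolding is_estimator_def by (simp add: measurable_cong_sets[OF sets_W refl])
  have ret: "(\<lambda>h. return ?R (H, h)) \<in> measurable (count_space \<H>) (prob_algebra ?R)"
    if "H \<in> \<H>" for H
    using that by (auto simp: space_prob_algebra intro: prob_space_return)
  have in1: "(\<lambda>A. K A \<bind> (\<lambda>h. return ?R (H, h))) \<in> measurable (W H) (prob_algebra ?R)"
    if "H \<in> \<H>" for H
    by (rule measurable_bind_prob_space[OF Kp ret[OF that]])
  have Wp: "W H \<in> space (prob_algebra (W H))" for H
    by (simp add: space_prob_algebra prob_space_W)
  \<comment> \<open>The uniform law lives on a discrete space, so only membership of the values has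
    to be checked; it is read off from \<open>in1\<close> composed with a constant kernel.\<close>
  have in2: "(\<lambda>H. W H \<bind> (\<lambda>A. K A \<bind> (\<lambda>h. return ?R (H, h))))
      \<in> measurable (uniform_count_measure \<H>) (prob_algebra ?R)"
  proof -
    have "W H \<bind> (\<lambda>A. K A \<bind> (\<lambda>h. return ?R (H, h))) \<in> space (prob_algebra ?R)"
      if "H \<in> \<H>" for H
      using measurable_space[OF measurable_bind_prob_space[OF measurable_const[OF Wp] in1[OF that]],
          of undefined "count_space UNIV"] by simp
    then show ?thesis
      by (auto simp: measurable_cong_sets[OF sets_uniform_count_measure_count_space refl])
  qed
  have U: "uniform_count_measure \<H> \<in> space (prob_algebra (uniform_count_measure \<H>))"
    using finite_H nonempty by (simp add: space_prob_algebra prob_space_uniform_count_measure)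
  have BR: "B \<in> sets ?R" using B by simp
  have *: "emeasure (W H \<bind> (\<lambda>A. K A \<bind> (\<lambda>h. return ?R (H, h)))) B
     = (\<integral>\<^sup>+A. emeasure (K A) {h \<in> \<H>. (H, h) \<in> B} \<partial>W H)" if H: "H \<in> \<H>" for H
  proof -
    have "emeasure (K A \<bind> (\<lambda>h. return ?R (H, h))) B = emeasure (K A) {h \<in> \<H>. (H, h) \<in> B}"
      if A: "A \<in> space (W H)" for A
    proof -
      have KA: "K A \<in> space (prob_algebra (count_space \<H>))"
        using measurable_space[OF Kp A] .
      then have s: "sets (K A) = Pow \<H>" by (simp add: space_prob_algebra)
      then have sp: "space (K A) = \<H>"
        using sets_eq_imp_space_eq[of "K A" "count_space \<H>"] by simp
      have "emeasure (K A \<bind> (\<lambda>h. return ?R (H, h))) B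
          = (\<integral>\<^sup>+h. emeasure (return ?R (H, h)) B \<partial>K A)"
        by (rule emeasure_bind_prob_algebra[OF KA ret[OF H] BR])
      also have "\<dots> = (\<integral>\<^sup>+h. indicator {h \<in> \<H>. (H, h) \<in> B} h \<partial>K A)"
        using B sp by (intro nn_integral_cong) (auto simp: indicator_def)
      also have "\<dots> = emeasure (K A) {h \<in> \<H>. (H, h) \<in> B}"
        using s by (intro nn_integral_indicator) auto
      finally show ?thesis .
    qed
    then show ?thesis
      by (subst emeasure_bind_prob_algebra[OF Wp in1[OF H] BR]) (intro nn_integral_cong, auto)
  qed
  have "emeasure (recovery_law n P Q \<H> K) B
     = (\<integral>\<^sup>+H. emeasure (W H \<bind> (\<lambda>A. K A \<bind> (\<lambda>h. return ?R (H, h)))) B \<partial>uniform_count_measure \<H>)"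
    unfolding recovery_law_def by (rule emeasure_bind_prob_algebra[OF U in2 BR])
  also have "\<dots> = (\<integral>\<^sup>+H. (\<integral>\<^sup>+A. emeasure (K A) {h \<in> \<H>. (H, h) \<in> B} \<partial>W H) \<partial>uniform_count_measure \<H>)"
    by (intro nn_integral_cong) (simp add: * space_uniform_count_measure)
  also have "\<dots> = (\<Sum>H\<in>\<H>. \<integral>\<^sup>+A. emeasure (K A) {h \<in> \<H>. (H, h) \<in> B} \<partial>W H) / card \<H>"
  proof -
    have "card \<H> > 0" using finite_H nonempty by (simp add: card_gt_0_iff)
    then have inv: "ennreal (1 / real (card \<H>)) = inverse (of_nat (card \<H>))"
      by (simp add: ennreal_of_nat_eq_real_of_nat inverse_ennreal inverse_eq_divide)
    show ?thesis
      unfolding uniform_count_measure_def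
      by (subst nn_integral_point_measure_finite[OF finite_H])
        (simp only: inv sum_distrib_left[symmetric] divide_ennreal_def mult.commute)
  qed
  finally show ?thesis .
qed

lemma measure_recovery_law_le:
  fixes c :: real
  assumes K: "is_estimator n Q \<H> K" and B: "B \<subseteq> \<H> \<times> \<H>" and c: "c \<ge> 0"
    and le: "(\<Sum>H\<in>\<H>. \<integral>\<^sup>+A. emeasure (K A) {h \<in> \<H>. (H, h) \<in> B} \<partial>W H) \<le> ennreal (card \<H> * c)"
  shows "measure (recovery_law n P Q \<H> K) B \<le> c"
proof -
  have M: "card \<H> > 0" using finite_H nonempty by (simp add: card_gt_0_iff)
  have "emeasure (recovery_law n P Q \<H> K) B \<le> ennreal (card \<H> * c) / card \<H>"
    unfolding emeasure_recovery_law[OF K B] by (rule divide_right_mono_ennreal[OF le])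
  also have "\<dots> = ennreal c"
    using M c by (simp add: ennreal_of_nat_eq_real_of_nat divide_ennreal)
  finally have "enn2real (emeasure (recovery_law n P Q \<H> K) B) \<le> enn2real (ennreal c)"
    by (rule enn2real_mono) simp
  then show ?thesis
    using c by (simp add: measure_def)
qed

subsection \<open>Overlap counts and the failure of estimators\<close>

text \<open>\<open>L\<close> is the log-cardinality of \<open>\<H>\<close> per edge.
  \<open>g\<close> is the worst logarithmic excess over an overlap law in which each shared edge
  costs a factor \<open>exp (- L)\<close>.\<close>

abbreviation "L \<equiv> ln (1 / p1M \<H> m)"
abbreviation "g \<equiv> real_of_ereal (overlap_max \<H> m)"

lemma card_H_eq:
  assumes m: "m > 0"
  shows "real (card \<H>) = exp (real m * L)"
proof -
  have M: "real (card \<H>) > 0" using finite_H nonempty by (simp add: card_gt_0_iff)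
  have "ln (1 / p1M \<H> m) = ln (real (card \<H>)) / real m"
    using M by (simp add: p1M_def ln_div ln_powr)
  then show ?thesis using m M by simp
qed

lemma card_overlap_le:
  assumes m: "m > 0" and H1: "H1 \<in> \<H>" and l: "l \<le> m"
  shows "real (card {H2 \<in> \<H>. card (H1 \<inter> H2) = l}) \<le> exp (real m * L + g - real l * L)"
proof -
  define N where "N H l = card {H2 \<in> \<H>. card (H \<inter> H2) = l}" for H l
  define u where "u H l = eln (emeasure (uniform_count_measure \<H>) {H2 \<in> \<H>. card (H \<inter> H2) = l})
       + ereal (real l * L)" for H l
  have M: "real (card \<H>) > 0" using finite_H nonempty by (simp add: card_gt_0_iff)
  have em: "emeasure (uniform_count_measure \<H>) {H2 \<in> \<H>. card (H \<inter> H2) = l}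
      = ennreal (real (N H l) / real (card \<H>))" for H l
    unfolding N_def by (subst emeasure_uniform_count_measure[OF finite_H]) auto
  have u: "u H l = (if N H l = 0 then -\<infinity> else ereal (ln (real (N H l) / real (card \<H>)) + real l * L))" for H l
    using M unfolding u_def em by (auto simp: eln_def ennreal_eq_0_iff divide_le_0_iff)
  have max: "overlap_max \<H> m = (MAX H1\<in>\<H>. MAX l\<in>{0..m}. u H1 l)"
    unfolding overlap_max_def u_def by simp
  have le: "u H l \<le> overlap_max \<H> m" if "H \<in> \<H>" "l \<le> m" for H l
  proof -
    have "u H l \<le> (MAX l\<in>{0..m}. u H l)" using that by (intro Max_ge) auto
    also have "\<dots> \<le> (MAX H\<in>\<H>. MAX l\<in>{0..m}. u H l)"
      using that finite_H by (intro Max_ge) auto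
    finally show ?thesis by (simp add: max)
  qed
  \<comment> \<open>\<open>real_of_ereal\<close> sends \<open>\<infinity>\<close> to 0, so the
    maximum must be shown not to be \<open>\<infinity>\<close> before \<open>g\<close> can serve as
    an upper bound. Empty overlap classes contribute \<open>-\<infinity>\<close> and are
    harmless.\<close>
  have not_inf: "(MAX l\<in>{0..m}. u H l) \<noteq> \<infinity>" for H
  proof -
    have "(MAX l\<in>{0..m}. u H l) \<in> u H ` {0..m}" by (intro Max_in) auto
    then show ?thesis by (auto simp: u)
  qed
  have "overlap_max \<H> m \<in> (\<lambda>H. MAX l\<in>{0..m}. u H l) ` \<H>"
    unfolding max using finite_H nonempty by (intro Max_in) auto
  then obtain H where "overlap_max \<H> m = (MAX l\<in>{0..m}. u H l)"
    by (rule imageE)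
  then have fin: "overlap_max \<H> m \<noteq> \<infinity>" using not_inf[of H] by (simp only: not_False_eq_True)
  show ?thesis
  proof (cases "N H1 l = 0")
    case True
    then show ?thesis by (simp add: N_def)
  next
    case False
    then have "ereal (ln (real (N H1 l) / real (card \<H>)) + real l * L) \<le> overlap_max \<H> m"
      using le[OF H1 l] by (simp add: u)
    with fin have "ln (real (N H1 l) / real (card \<H>)) + real l * L \<le> g"
      by (cases "overlap_max \<H> m") auto
    then have *: "ln (real (N H1 l)) \<le> real m * L + g - real l * L"
      using False M card_H_eq[OF m] by (simp add: ln_div)
    have "real (N H1 l) = exp (ln (real (N H1 l)))"
      using False by simp
    also have "\<dots> \<le> exp (real m * L + g - real l * L)"
      using * by (simp only: exp_le_cancel_iff)
    finally show ?thesis by (simp only: N_def)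
  qed
qed

text \<open>Grouping by overlap size leaves at most \<open>m + 1\<close> classes, each bounded by
  \<open>B\<close>. The weight \<open>\<phi>\<close> is a power of \<open>exp s\<close> in the
  impossibility bound and \<open>exp (- t * (m - l))\<close> in the recovery bound.\<close>

lemma sum_overlap_le:
  fixes \<phi> :: "nat \<Rightarrow> real"
  assumes m: "m > 0" and H1: "H1 \<in> \<H>" and \<phi>: "\<And>l. \<phi> l \<ge> 0" and B: "B \<ge> 0"
    and le: "\<And>l. l \<le> m \<Longrightarrow> R l \<Longrightarrow> exp (real m * L + g - real l * L) * \<phi> l \<le> B"
  shows "(\<Sum>H2 | H2 \<in> \<H> \<and> R (card (H1 \<inter> H2)). \<phi> (card (H1 \<inter> H2))) \<le> (real m + 1) * B"
proof -
  let ?S = "{H2 \<in> \<H>. R (card (H1 \<inter> H2))}"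
  have img: "(\<lambda>H2. card (H1 \<inter> H2)) ` ?S \<subseteq> {l. l \<le> m \<and> R l}"
    using card_mono[OF finite_graph[OF H1]] card_H[OF H1] by fastforce
  have "(\<Sum>H2\<in>?S. \<phi> (card (H1 \<inter> H2)))
      = (\<Sum>l | l \<le> m \<and> R l. \<Sum>H2 | H2 \<in> ?S \<and> card (H1 \<inter> H2) = l. \<phi> (card (H1 \<inter> H2)))"
    using finite_H img by (intro sum.group[symmetric]) auto
  also have "\<dots> \<le> (\<Sum>l | l \<le> m \<and> R l. B)"
  proof (rule sum_mono)
    fix l assume l: "l \<in> {l. l \<le> m \<and> R l}"
    then have "(\<Sum>H2 | H2 \<in> ?S \<and> card (H1 \<inter> H2) = l. \<phi> (card (H1 \<inter> H2)))
      = (\<Sum>H2 | H2 \<in> \<H> \<and> card (H1 \<inter> H2) = l. \<phi> l)"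
      by (intro sum.cong) auto
    also have "\<dots> = real (card {H2 \<in> \<H>. card (H1 \<inter> H2) = l}) * \<phi> l" by simp
    also have "\<dots> \<le> exp (real m * L + g - real l * L) * \<phi> l"
      using l by (intro mult_right_mono card_overlap_le m H1 \<phi>) auto
    also have "\<dots> \<le> B" using l le by auto
    finally show "(\<Sum>H2 | H2 \<in> ?S \<and> card (H1 \<inter> H2) = l. \<phi> (card (H1 \<inter> H2))) \<le> B" .
  qed
  also have "\<dots> = real (card {l. l \<le> m \<and> R l}) * B" by simp
  also have "\<dots> \<le> (real m + 1) * B"
  proof -
    have "card {l. l \<le> m \<and> R l} \<le> card {..m}" by (intro card_mono) auto
    then show ?thesis using B by (intro mult_right_mono) auto
  qed
  finally show ?thesis by simp
qed

section \<open>Estimator kernels and moments of the likelihood ratio\<close>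

lemma kernel_prob:
  assumes "is_estimator n Q \<H> K" "A \<in> space QE"
  shows "prob_space (K A)" "sets (K A) = Pow \<H>" "space (K A) = \<H>"
proof -
  have "K A \<in> space (prob_algebra (count_space \<H>))"
    using assms unfolding is_estimator_def by (rule measurable_space)
  then show "prob_space (K A)" "sets (K A) = Pow \<H>" by (simp_all add: space_prob_algebra)
  then show "space (K A) = \<H>" using sets_eq_imp_space_eq[of "K A" "count_space \<H>"] by simp
qed

lemma kernel_measurable:
  assumes "is_estimator n Q \<H> K" "X \<subseteq> \<H>"
  shows "(\<lambda>A. emeasure (K A) X) \<in> borel_measurable QE"
  using assms unfolding is_estimator_def
  by (intro measurable_compose[OF measurable_prob_algebraD measurable_emeasure_subprob_algebra]) auto

lemma nn_integral_f_le:
  assumes "renyi_div 2 P Q \<le> ereal s"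
  shows "(\<integral>\<^sup>+x. ennreal (f x) \<partial>P) \<le> ennreal (exp s)"
proof (rule eln_le_ereal)
  have "renyi_div 2 P Q = eln (\<integral>\<^sup>+x. ennreal (f x) \<partial>P)"
    unfolding renyi_div_def by (simp add: f_def one_ereal_def[symmetric])
  then show "eln (\<integral>\<^sup>+x. ennreal (f x) \<partial>P) \<le> ereal s" using assms by simp
qed

text \<open>At order \<open>1 - a\<close> the prefactor of the divergence is \<open>- 1 / a\<close>.
  Being negative, it turns a lower bound on the divergence into an upper bound on the
  moment.\<close>

lemma nn_integral_f_powr_le:
  assumes a: "a > 0" and c: "ereal c \<le> renyi_div (1 - a) P Q"
  shows "(\<integral>\<^sup>+x. ennreal (f x powr - a) \<partial>P) \<le> ennreal (exp (- a * c))"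
proof (rule eln_le_ereal)
  let ?I = "\<integral>\<^sup>+x. ennreal (f x powr - a) \<partial>P"
  have D: "renyi_div (1 - a) P Q = ereal (- 1 / a) * eln ?I"
    using a unfolding renyi_div_def by (simp add: f_def)
  show "eln ?I \<le> ereal (- a * c)"
  proof (cases "eln ?I")
    case (real z)
    then show ?thesis using c a by (simp add: D field_simps)
  next
    case PInf
    then show ?thesis using c a by (simp add: D)
  qed simp
qed

text \<open>An infinite value would make a moment of \<open>f powr - a\<close> vanish, although
  \<open>f\<close> is positive \<open>P\<close>-almost everywhere. Together with stability this
  later yields a finite KL divergence.\<close>

lemma renyi_div_less_1_finite:
  assumes a: "a > 0"
  shows "renyi_div (1 - a) P Q \<noteq> \<infinity>"
proof
  let ?I = "\<integral>\<^sup>+x. ennreal (f x powr - a) \<partial>P"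
  have D: "renyi_div (1 - a) P Q = ereal (- 1 / a) * eln ?I"
    using a unfolding renyi_div_def by (simp add: f_def)
  assume "renyi_div (1 - a) P Q = \<infinity>"
  then have "eln ?I = - \<infinity>" using a unfolding D by (cases "eln ?I") auto
  then have "?I = 0" by (simp add: eln_def split: if_splits)
  then have "AE x in P. ennreal (f x powr - a) = 0"
    by (subst (asm) nn_integral_0_iff_AE) auto
  with AE_f_pos have "AE x in P. False"
    by eventually_elim (simp add: ennreal_eq_0_iff)
  then show False by simp
qed

text \<open>An edge in exactly one of the graphs contributes \<open>E_Q f = 1\<close>; a shared edge
  contributes \<open>E_Q f^2 = E_P f\<close>.\<close>

lemma nn_integral_lik_mult:
  assumes H: "H1 \<in> \<H>" "H2 \<in> \<H>"
  shows "(\<integral>\<^sup>+A. ennreal (lik H1 A * lik H2 A) \<partial>QE)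
    = (\<integral>\<^sup>+x. ennreal (f x) \<partial>P) ^ card (H1 \<inter> H2)"
proof -
  have fin: "finite H1" "finite H2" using H finite_graph by auto
  let ?g = "\<lambda>e x. if e \<in> H1 \<inter> H2 then ennreal (f x) * ennreal (f x) else ennreal (f x)"
  have "ennreal (lik H1 A * lik H2 A) = (\<Prod>e\<in>H1 \<union> H2. ?g e (A e))" for A
  proof -
    have "lik H A = (\<Prod>e\<in>H1 \<union> H2. if e \<in> H then f (A e) else 1)" if "H = H1 \<or> H = H2" for H
      unfolding lik_def using fin that by (intro prod.mono_neutral_cong_left) auto
    then have "lik H1 A * lik H2 A
        = (\<Prod>e\<in>H1 \<union> H2. (if e \<in> H1 then f (A e) else 1) * (if e \<in> H2 then f (A e) else 1))"
      by (simp add: prod.distrib)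
    also have "ennreal \<dots> = (\<Prod>e\<in>H1 \<union> H2.
        ennreal ((if e \<in> H1 then f (A e) else 1) * (if e \<in> H2 then f (A e) else 1)))"
      by (rule prod_ennreal[symmetric]) (simp add: f_nonneg)
    also have "\<dots> = (\<Prod>e\<in>H1 \<union> H2. ?g e (A e))"
      by (intro prod.cong) (auto simp: f_nonneg ennreal_mult)
    finally show ?thesis .
  qed
  then have "(\<integral>\<^sup>+A. ennreal (lik H1 A * lik H2 A) \<partial>QE) = (\<integral>\<^sup>+A. (\<Prod>e\<in>H1 \<union> H2. ?g e (A e)) \<partial>QE)"
    by simp
  also have "\<dots> = (\<Prod>e\<in>H1 \<union> H2. integral\<^sup>N Q (?g e))"
    using subset_E H by (intro nn_integral_QE_prod) auto
  also have "\<dots> = (\<Prod>e\<in>H1 \<union> H2. if e \<in> H1 \<inter> H2 then \<integral>\<^sup>+x. ennreal (f x) \<partial>P else 1)"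
  proof (rule prod.cong[OF refl])
    fix e show "integral\<^sup>N Q (?g e) = (if e \<in> H1 \<inter> H2 then \<integral>\<^sup>+x. ennreal (f x) \<partial>P else 1)"
      by (cases "e \<in> H1 \<inter> H2") (simp_all only: if_True if_False nn_integral_f nn_integral_f_square)
  qed
  also have "\<dots> = (\<Prod>e\<in>H1 \<inter> H2. \<integral>\<^sup>+x. ennreal (f x) \<partial>P)"
    using fin by (intro prod.mono_neutral_cong_right) auto
  finally show ?thesis by simp
qed

text \<open>Under the null law the second-moment bound holds for every possible output, so it
  survives averaging over the kernel. The free parameter \<open>c\<close> trades the two error terms
  against each other.\<close>

lemma estimator_overlap_bound:
  assumes K: "is_estimator n Q \<H> K" and m: "m > 0" and r: "r > 0" and c: "c > 0"
    and D2: "renyi_div 2 P Q \<le> ereal s" and s: "s \<le> L"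
  shows "measure (recovery_law n P Q \<H> K) {(Hstar, Hhat) \<in> \<H> \<times> \<H>. r * real m \<le> real (card (Hhat \<inter> Hstar))}
    \<le> c / 2 + (real m + 1) * exp (g - (L - s) * (r\<^sup>2 / 2 * real m)) / (r\<^sup>2 * c)"
    (is "measure _ ?B \<le> c / 2 + ?C / (r\<^sup>2 * c)")
proof (rule measure_recovery_law_le[OF K])
  define M where "M = real (card \<H>)"
  have M: "M > 0" using finite_H nonempty by (simp add: card_gt_0_iff M_def)
  define T where "T A = (\<Sum>H1\<in>\<H>. \<Sum>H2 | H2 \<in> \<H> \<and> r\<^sup>2 / 2 * m \<le> card (H1 \<inter> H2).
    lik H1 A * lik H2 A)" for A
  have T0: "T A \<ge> 0" for A
    unfolding T_def by (intro sum_nonneg mult_nonneg_nonneg lik_nonneg)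
  have [measurable]: "lik H \<in> borel_measurable QE" if "H \<in> \<H>" for H
    using subset_E[OF that] by (rule lik_measurable)
  have mW: "(\<Sum>H | H \<in> \<H> \<and> r * real m \<le> real (card (h \<inter> H)). lik H A)
      \<le> M * (c / 2) + T A / (r\<^sup>2 * c * M)" if h: "h \<in> \<H>" for h A
  proof -
    define x where "x = (\<Sum>H | H \<in> \<H> \<and> r * real m \<le> real (card (h \<inter> H)). lik H A)"
    have "r\<^sup>2 / 2 * x\<^sup>2 \<le> T A"
      unfolding x_def T_def
      by (rule weighted_overlap_second_moment[OF finite_H _ _ h m r])
        (auto simp: lik_nonneg card_H finite_graph)
    then have "x\<^sup>2 / (2 * M * c) \<le> T A / (r\<^sup>2 * c * M)"
      using r M c by (simp add: field_simps)
    \<comment> \<open>The inequality of arithmetic and geometric means replaces the first power of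
      \<open>x\<close> by its square, avoiding a square root of an expectation.\<close>
    moreover have "x \<le> M * (c / 2) + x\<^sup>2 / (2 * M * c)"
    proof -
      have "0 \<le> (x - M * c)\<^sup>2 / (2 * M * c)" using M c by simp
      also have "\<dots> = M * (c / 2) + x\<^sup>2 / (2 * M * c) - x"
        using M c by (simp add: field_simps power2_eq_square)
      finally show ?thesis by simp
    qed
    ultimately show ?thesis by (simp add: x_def)
  qed
  let ?X = "\<lambda>H. {h \<in> \<H>. (H, h) \<in> ?B}"
  \<comment> \<open>Changing to the null law puts all hidden graphs under one integral, so that
    their sum can be moved inside.\<close>
  have "(\<Sum>H\<in>\<H>. \<integral>\<^sup>+A. emeasure (K A) (?X H) \<partial>W H)
      = (\<Sum>H\<in>\<H>. \<integral>\<^sup>+A. ennreal (lik H A) * emeasure (K A) (?X H) \<partial>QE)"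
  proof (rule sum.cong[OF refl])
    fix H assume "H \<in> \<H>"
    then show "(\<integral>\<^sup>+A. emeasure (K A) (?X H) \<partial>W H)
        = (\<integral>\<^sup>+A. ennreal (lik H A) * emeasure (K A) (?X H) \<partial>QE)"
      unfolding weights_density[OF subset_E[OF \<open>H \<in> \<H>\<close>]]
      by (intro nn_integral_density kernel_measurable[OF K]) auto
  qed
  also have "\<dots> = (\<integral>\<^sup>+A. (\<Sum>H\<in>\<H>. ennreal (lik H A) * emeasure (K A) (?X H)) \<partial>QE)"
    by (intro nn_integral_sum[symmetric] borel_measurable_times_ennreal kernel_measurable[OF K]) auto
  also have "\<dots> \<le> (\<integral>\<^sup>+A. ennreal (M * (c / 2) + T A / (r\<^sup>2 * c * M)) \<partial>QE)"
  proof (rule nn_integral_mono)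
    fix A assume A: "A \<in> space QE"
    note KA = kernel_prob[OF K A]
    have "(\<Sum>H\<in>\<H>. ennreal (lik H A) * emeasure (K A) (?X H))
        = (\<Sum>H\<in>\<H>. \<integral>\<^sup>+h. ennreal (lik H A) * indicator (?X H) h \<partial>K A)"
      by (intro sum.cong refl nn_integral_cmult_indicator[symmetric]) (auto simp: KA)
    also have "\<dots> = (\<integral>\<^sup>+h. (\<Sum>H\<in>\<H>. ennreal (lik H A) * indicator (?X H) h) \<partial>K A)"
      by (intro nn_integral_sum[symmetric] borel_measurable_times_ennreal
          borel_measurable_indicator) (auto simp: KA)
    also have "\<dots> \<le> (\<integral>\<^sup>+h. ennreal (M * (c / 2) + T A / (r\<^sup>2 * c * M)) \<partial>K A)"
    proof (rule nn_integral_mono)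
      fix h assume "h \<in> space (K A)"
      then have h: "h \<in> \<H>" by (simp add: KA)
      have "(\<Sum>H\<in>\<H>. ennreal (lik H A) * indicator (?X H) h)
          = (\<Sum>H | H \<in> \<H> \<and> r * real m \<le> real (card (h \<inter> H)). ennreal (lik H A))"
        using finite_H h by (intro sum.mono_neutral_cong_right) (auto simp: indicator_def)
      also have "\<dots> = ennreal (\<Sum>H | H \<in> \<H> \<and> r * real m \<le> real (card (h \<inter> H)). lik H A)"
        by (intro sum_ennreal lik_nonneg)
      also have "\<dots> \<le> ennreal (M * (c / 2) + T A / (r\<^sup>2 * c * M))"
        by (intro ennreal_leI mW h)
      finally show "(\<Sum>H\<in>\<H>. ennreal (lik H A) * indicator (?X H) h) \<le> \<dots>" .
    qed
    also have "\<dots> = ennreal (M * (c / 2) + T A / (r\<^sup>2 * c * M))"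
      using KA(1) by (simp add: prob_space.emeasure_space_1)
    finally show "(\<Sum>H\<in>\<H>. ennreal (lik H A) * emeasure (K A) (?X H)) \<le> \<dots>" .
  qed
  also have "\<dots> = (\<integral>\<^sup>+A. ennreal (M * (c / 2)) + ennreal (1 / (r\<^sup>2 * c * M)) * ennreal (T A) \<partial>QE)"
  proof (rule nn_integral_cong)
    fix A
    have "ennreal (1 / (r\<^sup>2 * c * M)) * ennreal (T A) = ennreal (T A / (r\<^sup>2 * c * M))"
      using M c r T0 by (subst ennreal_mult[symmetric]) auto
    moreover have "T A / (r\<^sup>2 * c * M) \<ge> 0"
      using M c r T0 by auto
    ultimately show "ennreal (M * (c / 2) + T A / (r\<^sup>2 * c * M))
        = ennreal (M * (c / 2)) + ennreal (1 / (r\<^sup>2 * c * M)) * ennreal (T A)"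
      using M c by (simp only:) (subst ennreal_plus, auto)
  qed
  also have "\<dots> = ennreal (M * (c / 2)) + ennreal (1 / (r\<^sup>2 * c * M)) * (\<integral>\<^sup>+A. ennreal (T A) \<partial>QE)"
  proof -
    have "T \<in> borel_measurable QE"
      unfolding T_def by (intro borel_measurable_sum borel_measurable_times) auto
    then show ?thesis
      by (simp add: nn_integral_add nn_integral_cmult prob_space.emeasure_space_1[OF prob_space_QE])
  qed
  also have "(\<integral>\<^sup>+A. ennreal (T A) \<partial>QE)
      = (\<Sum>H1\<in>\<H>. \<Sum>H2 | H2 \<in> \<H> \<and> r\<^sup>2 / 2 * m \<le> card (H1 \<inter> H2).
          \<integral>\<^sup>+A. ennreal (lik H1 A * lik H2 A) \<partial>QE)"
  proof -
    have "ennreal (T A) = (\<Sum>H1\<in>\<H>. \<Sum>H2 | H2 \<in> \<H> \<and> r\<^sup>2 / 2 * m \<le> card (H1 \<inter> H2).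
        ennreal (lik H1 A * lik H2 A))" for A
      by (simp add: T_def sum_ennreal sum_nonneg lik_nonneg)
    moreover have "(\<lambda>A. ennreal (lik H1 A * lik H2 A)) \<in> borel_measurable QE"
      if "H1 \<in> \<H>" "H2 \<in> \<H>" for H1 H2
      using that by measurable
    ultimately show ?thesis
      by (auto simp only: mem_Collect_eq intro!: sum.cong borel_measurable_sum
          nn_integral_sum[THEN trans])
  qed
  also have "\<dots> \<le> (\<Sum>H1\<in>\<H>. \<Sum>H2 | H2 \<in> \<H> \<and> r\<^sup>2 / 2 * m \<le> card (H1 \<inter> H2).
      ennreal (exp s ^ card (H1 \<inter> H2)))"
  proof (intro sum_mono)
    fix H1 H2 assume "H1 \<in> \<H>" "H2 \<in> {H2. H2 \<in> \<H> \<and> r\<^sup>2 / 2 * m \<le> card (H1 \<inter> H2)}"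
    then have "(\<integral>\<^sup>+A. ennreal (lik H1 A * lik H2 A) \<partial>QE) = (\<integral>\<^sup>+x. ennreal (f x) \<partial>P) ^ card (H1 \<inter> H2)"
      by (intro nn_integral_lik_mult) auto
    also have "\<dots> \<le> ennreal (exp s) ^ card (H1 \<inter> H2)"
      using nn_integral_f_le[OF D2] by (rule power_mono) simp
    finally show "(\<integral>\<^sup>+A. ennreal (lik H1 A * lik H2 A) \<partial>QE) \<le> ennreal (exp s ^ card (H1 \<inter> H2))"
      by (simp add: ennreal_power)
  qed
  also have "\<dots> = ennreal (\<Sum>H1\<in>\<H>. \<Sum>H2 | H2 \<in> \<H> \<and> r\<^sup>2 / 2 * m \<le> card (H1 \<inter> H2).
      exp s ^ card (H1 \<inter> H2))"
    by (simp add: sum_ennreal sum_nonneg)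
  also have "\<dots> \<le> ennreal (M * (M * ?C))"
  proof (rule ennreal_leI)
    have "(\<Sum>H2 | H2 \<in> \<H> \<and> r\<^sup>2 / 2 * m \<le> card (H1 \<inter> H2). exp s ^ card (H1 \<inter> H2)) \<le> M * ?C"
      if H1: "H1 \<in> \<H>" for H1
    proof -
      have "(\<Sum>H2 | H2 \<in> \<H> \<and> r\<^sup>2 / 2 * m \<le> card (H1 \<inter> H2). exp s ^ card (H1 \<inter> H2))
        \<le> (real m + 1) * (M * exp (g - (L - s) * (r\<^sup>2 / 2 * real m)))"
      proof (rule sum_overlap_le[OF m H1])
        \<comment> \<open>As \<open>s \<le> L\<close>, the exponent is largest at the smallest
          admissible overlap.\<close>
        fix l assume "l \<le> m" "r\<^sup>2 / 2 * real m \<le> real l"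
        then have "(L - s) * (r\<^sup>2 / 2 * real m) \<le> (L - s) * real l"
          using s by (intro mult_left_mono) auto
        then have "real m * L + g - real l * L + real l * s
            \<le> real m * L + (g - (L - s) * (r\<^sup>2 / 2 * real m))"
          by (simp add: algebra_simps)
        then show "exp (real m * L + g - real l * L) * exp s ^ l
            \<le> M * exp (g - (L - s) * (r\<^sup>2 / 2 * real m))"
          unfolding M_def card_H_eq[OF m] by (simp flip: exp_add exp_of_nat_mult)
      qed (use M in auto)
      then show ?thesis by (simp add: mult_ac)
    qed
    from sum_mono[of \<H>, OF this]
    show "(\<Sum>H1\<in>\<H>. \<Sum>H2 | H2 \<in> \<H> \<and> r\<^sup>2 / 2 * m \<le> card (H1 \<inter> H2). exp s ^ card (H1 \<inter> H2))
      \<le> M * (M * ?C)"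
      by (simp add: M_def)
  qed
  also have "ennreal (M * (c / 2)) + ennreal (1 / (r\<^sup>2 * c * M)) * ennreal (M * (M * ?C))
      = ennreal (M * (c / 2 + ?C / (r\<^sup>2 * c)))"
  proof -
    define C where "C = ?C"
    have C: "C \<ge> 0" by (simp add: C_def)
    have "ennreal (1 / (r\<^sup>2 * c * M)) * ennreal (M * (M * C)) = ennreal (M * (C / (r\<^sup>2 * c)))"
      using M c r C by (subst ennreal_mult[symmetric]) auto
    moreover have "M * (C / (r\<^sup>2 * c)) \<ge> 0" "M * (c / 2) \<ge> 0"
      using M c r C by auto
    ultimately show ?thesis
      unfolding C_def[symmetric] distrib_left by (simp only: ennreal_plus)
  qed
  finally show "(\<Sum>H\<in>\<H>. \<integral>\<^sup>+A. emeasure (K A) (?X H) \<partial>W H)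
      \<le> ennreal (real (card \<H>) * (c / 2 + ?C / (r\<^sup>2 * c)))"
    by (simp add: M_def add_left_mono mult_left_mono)
qed (use c r in \<open>auto intro!: add_nonneg_nonneg divide_nonneg_nonneg\<close>)

subsection \<open>Recovery by maximum likelihood\<close>

lemma log_likelihood_eq:
  assumes "H \<in> \<H>" "\<forall>e\<in>E. RN_deriv Q P (A e) = ennreal (f (A e))"
  shows "log_likelihood P Q H A = eln (ennreal (lik H A))"
proof -
  have "log_likelihood P Q H A = (\<Sum>e\<in>H. eln (ennreal (f (A e))))"
    unfolding log_likelihood_def using assms subset_E[OF assms(1)] by (intro sum.cong) auto
  then show ?thesis
    by (simp add: lik_def sum_eln_ennreal f_nonneg)
qed

text \<open>Maximality holds almost everywhere under the null law and passes to the planted law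
  through its density. Only points with \<open>lik Hs A > 0\<close> matter there, and at these
  points comparing logarithms does compare likelihoods.\<close>

lemma AE_MLE_optimal:
  assumes K: "is_MLE n P Q \<H> K" and Hs: "Hs \<in> \<H>"
  shows "AE A in W Hs. (\<forall>e\<in>Hs. f (A e) > 0) \<and> (AE h in K A. lik Hs A \<le> lik h A)"
proof -
  have 1: "AE A in QE. \<forall>e\<in>E. RN_deriv Q P (A e) = ennreal (f (A e))"
    using finite_E by (subst AE_finite_all) (auto intro!: AE_PiM_component prob_Q AE_RN_deriv)
  have 2: "AE A in QE. AE h in K A. \<forall>H'\<in>\<H>. log_likelihood P Q H' A \<le> log_likelihood P Q h A"
    using K unfolding is_MLE_def by blast
  have est: "is_estimator n Q \<H> K" using K unfolding is_MLE_def by blast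
  have "AE A in QE. 0 < ennreal (lik Hs A) \<longrightarrow>
      (\<forall>e\<in>Hs. f (A e) > 0) \<and> (AE h in K A. lik Hs A \<le> lik h A)"
    using 1 2 AE_space
  proof eventually_elim
    case (elim A)
    show ?case
    proof (intro impI conjI)
      assume pos: "0 < ennreal (lik Hs A)"
      then show "\<forall>e\<in>Hs. f (A e) > 0"
        using finite_graph[OF Hs] f_nonneg unfolding lik_def
        by (metis ennreal_0 less_irrefl order_le_less prod_zero)
      show "AE h in K A. lik Hs A \<le> lik h A"
        using elim(2) AE_space
      proof eventually_elim
        case (elim h)
        then have h: "h \<in> \<H>" using kernel_prob(3)[OF est \<open>A \<in> space QE\<close>] by simp
        show ?case
          using elim(1) Hs pos log_likelihood_eq[OF _ \<open>\<forall>e\<in>E. _ e\<close>] h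
          by (intro eln_ennreal_le_imp_le) (auto simp: ennreal_less_zero_iff)
      qed
    qed
  qed
  then show ?thesis
    unfolding weights_density[OF subset_E[OF Hs]]
    by (subst AE_density) (use subset_E[OF Hs] in auto)
qed

text \<open>
  The error event is covered by two kinds of deviations from the threshold \<open>exp (t * k)\<close>, where
  \<open>k\<close> is the number of edges of the hidden graph that are missed.
\<close>

lemma lik_deviation:
  fixes a t :: real
  assumes Hs: "Hs \<in> \<H>" and h: "h \<in> \<H>" and a: "a > 0"
    and pos: "\<forall>e\<in>Hs. f (A e) > 0" and le: "lik Hs A \<le> lik h A"
  shows "1 \<le> exp (a * t * card (Hs - h)) * (\<Prod>e\<in>Hs - h. f (A e) powr - a) \<or>
    1 \<le> exp (- t * card (Hs - h)) * (\<Prod>e\<in>h - Hs. f (A e))"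
proof -
  let ?p = "\<lambda>S. \<Prod>e\<in>S. f (A e)"
  have fin: "finite Hs" "finite h" using Hs h finite_graph by auto
  have split: "lik Hs A = ?p (Hs - h) * ?p (Hs \<inter> h)" "lik h A = ?p (h - Hs) * ?p (Hs \<inter> h)"
    unfolding lik_def
    using prod.Int_Diff[OF fin(1), of "\<lambda>e. f (A e)" h] prod.Int_Diff[OF fin(2), of "\<lambda>e. f (A e)" Hs]
    by (simp_all only: Int_commute mult.commute)
  \<comment> \<open>The common edges lie in \<open>Hs\<close>, so their product is positive and
    cancels.\<close>
  have "?p (Hs \<inter> h) > 0" and p0: "?p (Hs - h) > 0" using pos by (auto intro!: prod_pos)
  with le have le': "?p (Hs - h) \<le> ?p (h - Hs)" unfolding split by simp
  define k where "k = real (card (Hs - h))"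
  \<comment> \<open>If the product over the missed edges is at most \<open>exp (t * k)\<close>, its
    power \<open>- a\<close> is large. Otherwise the product over the wrong edges, which is no
    smaller, exceeds the threshold.\<close>
  show ?thesis
  proof (cases "?p (Hs - h) \<le> exp (t * k)")
    case True
    have "exp (- a * t * k) = exp (t * k) powr - a"
      by (simp add: powr_def mult_ac)
    also have "\<dots> \<le> ?p (Hs - h) powr - a"
      using True p0 a by (intro powr_mono2') auto
    also have "\<dots> = (\<Prod>e\<in>Hs - h. f (A e) powr - a)"
      by (rule prod_powr_distrib)
    finally have "exp (a * t * k) * exp (- a * t * k) \<le> exp (a * t * k) * (\<Prod>e\<in>Hs - h. f (A e) powr - a)"
      by (intro mult_left_mono) auto
    then show ?thesis by (simp add: k_def flip: exp_add)
  next
    case False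
    with le' have "exp (- t * k) * exp (t * k) \<le> exp (- t * k) * ?p (h - Hs)"
      by (intro mult_left_mono) auto
    then show ?thesis by (simp add: k_def flip: exp_add)
  qed
qed

lemma card_diff_H:
  assumes "H1 \<in> \<H>" "H2 \<in> \<H>"
  shows "real (card (H1 - H2)) = real m - real (card (H1 \<inter> H2))"
  using card_Diff_subset_Int[of H1 H2] card_mono[of H1 "H1 \<inter> H2"] assms finite_graph card_H
  by (simp add: of_nat_diff)

text \<open>The first deviation depends on the estimate only through \<open>Hs - h\<close>, so its
  union bound runs over at most \<open>2 ^ m\<close> subsets of \<open>Hs\<close> instead of over
  all graphs. The threshold \<open>t\<close> may be placed anywhere between \<open>L\<close> and
  \<open>c\<close>.\<close>

lemma MLE_overlap_bound:
  assumes K: "is_MLE n P Q \<H> K" and m: "m > 0" and \<delta>: "\<delta> > 0" and a: "a > 0"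
    and c: "ereal c \<le> renyi_div (1 - a) P Q" and t: "L \<le> t" "t \<le> c"
  shows "measure (recovery_law n P Q \<H> K)
      {(Hstar, Hhat) \<in> \<H> \<times> \<H>. real (card (Hhat \<inter> Hstar)) < (1 - \<delta>) * real m}
    \<le> 2 ^ m * exp (- (a * (c - t) * (\<delta> * real m))) + (real m + 1) * exp (g - (t - L) * (\<delta> * real m))"
    (is "measure _ ?B \<le> ?b1 + ?b2")
proof (rule measure_recovery_law_le)
  show est: "is_estimator n Q \<H> K" using K unfolding is_MLE_def by blast
  let ?X = "\<lambda>H. {h \<in> \<H>. (H, h) \<in> ?B}"
  have "(\<integral>\<^sup>+A. emeasure (K A) (?X Hs) \<partial>W Hs) \<le> ennreal (?b1 + ?b2)" if Hs: "Hs \<in> \<H>" for Hs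
  proof -
    have finHs: "finite Hs" and HsE: "Hs \<subseteq> E" and cardHs: "card Hs = m"
      using Hs finite_graph subset_E card_H by auto
    define S1 where "S1 = {S. S \<subseteq> Hs \<and> \<delta> * m \<le> card S}"
    define S2 where "S2 = {h \<in> \<H>. card (Hs \<inter> h) < (1 - \<delta>) * m}"
    \<comment> \<open>The terms are normalised so that a deviation reads \<open>1 \<le> t1\<close>
      or \<open>1 \<le> t2\<close>; integrating them then performs Markov's inequality.\<close>
    define t1 where "t1 S A = ennreal (exp (a * t * card S)) * (\<Prod>e\<in>S. ennreal (f (A e) powr - a))"
      for S :: graph and A :: "edge \<Rightarrow> 'a"
    define t2 where "t2 h A = ennreal (exp (- t * card (Hs - h))) * (\<Prod>e\<in>h - Hs. ennreal (f (A e)))"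
      for h :: graph and A :: "edge \<Rightarrow> 'a"
    have fin1: "finite S1" using finHs by (auto simp: S1_def)
    have fin2: "finite S2" using finite_H by (auto simp: S2_def)
    have mW: "borel_measurable (W Hs) = borel_measurable QE"
      by (rule measurable_cong_sets[OF sets_W refl])
    have mprod: "(\<lambda>A. \<Prod>e\<in>S. ennreal (u (A e))) \<in> borel_measurable (W Hs)"
      if S: "S \<subseteq> E" and u: "u \<in> borel_measurable Q" for S and u :: "'a \<Rightarrow> real"
      unfolding mW
    proof (rule borel_measurable_prod_ennreal)
      fix e assume "e \<in> S"
      then have "(\<lambda>A. A e) \<in> measurable QE Q"
        using S by (intro measurable_component_singleton) auto
      from measurable_compose[OF this u]
      show "(\<lambda>A. ennreal (u (A e))) \<in> borel_measurable QE"
        by (rule measurable_compose[OF _ measurable_ennreal])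
    qed
    have fa: "(\<lambda>x. f x powr - a) \<in> borel_measurable Q" by measurable
    have m1: "t1 S \<in> borel_measurable (W Hs)" if "S \<in> S1" for S
      unfolding t1_def using that HsE
      by (intro borel_measurable_times_ennreal borel_measurable_const mprod fa) (auto simp: S1_def)
    have m2: "t2 h \<in> borel_measurable (W Hs)" if "h \<in> S2" for h
      unfolding t2_def using that subset_E
      by (intro borel_measurable_times_ennreal borel_measurable_const mprod f_measurable_Q)
        (auto simp: S2_def)
    have "AE A in W Hs. emeasure (K A) (?X Hs) \<le> (\<Sum>S\<in>S1. t1 S A) + (\<Sum>h\<in>S2. t2 h A)"
      using AE_MLE_optimal[OF K Hs] AE_space
    proof eventually_elim
      case (elim A)
      then have A: "A \<in> space QE" by (simp add: space_W)
      note KA = kernel_prob[OF est A]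
      show ?case
      \<comment> \<open>If no erroneous graph is at least as likely as \<open>Hs\<close>, the kernel
        gives the error set mass 0. Otherwise some term is at least 1 and dominates any probability,
        whatever the tie-breaking.\<close>
      proof (cases "\<exists>h\<in>?X Hs. lik Hs A \<le> lik h A")
        case False
        have "AE h in K A. h \<notin> ?X Hs"
          using elim(1)[THEN conjunct2] by eventually_elim (use False in auto)
        then have "emeasure (K A) (?X Hs) = 0"
          by (subst (asm) AE_iff_measurable[where N = "?X Hs"]) (auto simp: KA)
        then show ?thesis by simp
      next
        case True
        then obtain h where h: "h \<in> \<H>" "real (card (h \<inter> Hs)) < (1 - \<delta>) * m" "lik Hs A \<le> lik h A"
          by auto
        have h2: "h \<in> S2" using h by (simp add: S2_def Int_commute)
        have "\<delta> * m \<le> card (Hs - h)"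
          using h card_diff_H[OF Hs h(1)] by (simp add: Int_commute algebra_simps)
        then have h1: "Hs - h \<in> S1" by (simp add: S1_def)
        have "1 \<le> t1 (Hs - h) A \<or> 1 \<le> t2 h A"
          using lik_deviation[OF Hs h(1) a elim(1)[THEN conjunct1] h(3), of t]
          unfolding t1_def t2_def
          by (auto simp: prod_ennreal f_nonneg prod_nonneg ennreal_mult[symmetric])
        moreover have "t1 (Hs - h) A \<le> (\<Sum>S\<in>S1. t1 S A)"
          using h1 fin1 by (intro member_le_sum) auto
        moreover have "t2 h A \<le> (\<Sum>h\<in>S2. t2 h A)"
          using h2 fin2 by (intro member_le_sum) auto
        ultimately have "1 \<le> (\<Sum>S\<in>S1. t1 S A) + (\<Sum>h\<in>S2. t2 h A)"
          by (meson add_increasing add_increasing2 order_trans zero_le)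
        moreover have "emeasure (K A) (?X Hs) \<le> 1"
          by (rule prob_space.emeasure_le_1[OF KA(1)])
        ultimately show ?thesis by (rule order_trans[rotated])
      qed
    qed
    then have "(\<integral>\<^sup>+A. emeasure (K A) (?X Hs) \<partial>W Hs)
        \<le> (\<integral>\<^sup>+A. (\<Sum>S\<in>S1. t1 S A) + (\<Sum>h\<in>S2. t2 h A) \<partial>W Hs)"
      by (rule nn_integral_mono_AE)
    also have "\<dots> = (\<Sum>S\<in>S1. integral\<^sup>N (W Hs) (t1 S)) + (\<Sum>h\<in>S2. integral\<^sup>N (W Hs) (t2 h))"
      using m1 m2 by (simp add: nn_integral_add nn_integral_sum borel_measurable_sum)
    also have "(\<Sum>S\<in>S1. integral\<^sup>N (W Hs) (t1 S)) \<le> ennreal ?b1"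
    proof -
      have "integral\<^sup>N (W Hs) (t1 S) \<le> ennreal (exp (- (a * (c - t) * (\<delta> * real m))))" if S: "S \<in> S1" for S
      proof -
        have SHs: "S \<subseteq> Hs" using S by (simp add: S1_def)
        have "integral\<^sup>N (W Hs) (t1 S)
            = ennreal (exp (a * t * card S)) * (\<Prod>e\<in>S. \<integral>\<^sup>+x. ennreal (f x powr - a) \<partial>(if e \<in> Hs then P else Q))"
          unfolding t1_def using SHs HsE fa
          by (subst nn_integral_cmult, intro mprod fa, blast)
            (subst nn_integral_W_prod, auto)
        also have "(\<Prod>e\<in>S. \<integral>\<^sup>+x. ennreal (f x powr - a) \<partial>(if e \<in> Hs then P else Q))
            = (\<integral>\<^sup>+x. ennreal (f x powr - a) \<partial>P) ^ card S"
          using SHs by (subst prod.cong[OF refl, of _ _ "\<lambda>_. \<integral>\<^sup>+x. ennreal (f x powr - a) \<partial>P"]) auto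
        also have "\<dots> \<le> ennreal (exp (- a * c)) ^ card S"
          using nn_integral_f_powr_le[OF a c] by (rule power_mono) simp
        also have "ennreal (exp (a * t * card S)) * ennreal (exp (- a * c)) ^ card S
            = ennreal (exp (- (a * (c - t) * card S)))"
          by (simp add: ennreal_power ennreal_mult[symmetric] exp_of_nat_mult[symmetric]
              exp_add[symmetric] algebra_simps)
        also have "\<dots> \<le> ennreal (exp (- (a * (c - t) * (\<delta> * real m))))"
        proof -
          have "a * (c - t) * (\<delta> * real m) \<le> a * (c - t) * card S"
            using S a t by (intro mult_left_mono) (auto simp: S1_def)
          then show ?thesis by (intro ennreal_leI) simp
        qed
        finally show ?thesis by (simp add: mult_left_mono)
      qed
      then have "(\<Sum>S\<in>S1. integral\<^sup>N (W Hs) (t1 S))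
          \<le> of_nat (card S1) * ennreal (exp (- (a * (c - t) * (\<delta> * real m))))"
        by (rule sum_bounded_above)
      also have "\<dots> \<le> of_nat (2 ^ m) * ennreal (exp (- (a * (c - t) * (\<delta> * real m))))"
      proof -
        have "card S1 \<le> card (Pow Hs)" using finHs by (intro card_mono) (auto simp: S1_def)
        then have "card S1 \<le> 2 ^ m" using finHs cardHs by (simp add: card_Pow)
        then show ?thesis by (intro mult_right_mono of_nat_mono) auto
      qed
      also have "\<dots> = ennreal ?b1"
        by (simp only: ennreal_of_nat_eq_real_of_nat) (simp add: ennreal_mult)
      finally show ?thesis .
    qed
    also have "(\<Sum>h\<in>S2. integral\<^sup>N (W Hs) (t2 h)) \<le> ennreal ?b2"
    proof -
      have "integral\<^sup>N (W Hs) (t2 h) = ennreal (exp (- t * (real m - card (Hs \<inter> h))))" if h: "h \<in> S2" for h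
      proof -
        have hH: "h \<in> \<H>" using h by (simp add: S2_def)
        have "integral\<^sup>N (W Hs) (t2 h)
            = ennreal (exp (- t * card (Hs - h))) * (\<Prod>e\<in>h - Hs. \<integral>\<^sup>+x. ennreal (f x) \<partial>(if e \<in> Hs then P else Q))"
          unfolding t2_def using subset_E[OF hH]
          by (subst nn_integral_cmult, intro mprod f_measurable_Q, blast)
            (subst nn_integral_W_prod, auto)
        \<comment> \<open>Wrong edges carry the law \<open>Q\<close>, under which \<open>f\<close>
          has mean 1.\<close>
        also have "(\<Prod>e\<in>h - Hs. \<integral>\<^sup>+x. ennreal (f x) \<partial>(if e \<in> Hs then P else Q)) = 1"
          by (intro prod.neutral) (auto simp: nn_integral_f)
        finally show ?thesis by (simp only: card_diff_H[OF Hs hH] mult_1_right)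
      qed
      then have "(\<Sum>h\<in>S2. integral\<^sup>N (W Hs) (t2 h))
          = (\<Sum>h\<in>S2. ennreal (exp (- t * (real m - card (Hs \<inter> h)))))"
        by (rule sum.cong[OF refl])
      also have "\<dots> = ennreal (\<Sum>h\<in>S2. exp (- t * (real m - card (Hs \<inter> h))))"
        by (rule sum_ennreal) simp
      also have "\<dots> \<le> ennreal ?b2"
        unfolding S2_def
      proof (intro ennreal_leI sum_overlap_le[OF m Hs, where R = "\<lambda>l. real l < (1 - \<delta>) * real m"
            and \<phi> = "\<lambda>l. exp (- t * (real m - real l))"])
        \<comment> \<open>The exponents combine to \<open>g - (t - L) * (m - l)\<close>, where
          \<open>t \<ge> L\<close> and \<open>m - l\<close> exceeds
          \<open>\<delta> * m\<close>.\<close>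
        fix l assume "real l < (1 - \<delta>) * real m"
        then have "(t - L) * (\<delta> * real m) \<le> (t - L) * (real m - real l)"
          using t by (intro mult_left_mono) (auto simp: algebra_simps)
        then have "real m * L + g - real l * L + - t * (real m - real l) \<le> g - (t - L) * (\<delta> * real m)"
          by (simp add: algebra_simps)
        then show "exp (real m * L + g - real l * L) * exp (- t * (real m - real l))
            \<le> exp (g - (t - L) * (\<delta> * real m))"
          by (simp only: exp_add[symmetric] exp_le_cancel_iff)
      qed auto
      finally show ?thesis .
    qed
    finally show ?thesis by (simp add: add_mono)
  qed
  then have "(\<Sum>H\<in>\<H>. \<integral>\<^sup>+A. emeasure (K A) (?X H) \<partial>W H) \<le> of_nat (card \<H>) * ennreal (?b1 + ?b2)"
    by (rule sum_bounded_above)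
  also have "\<dots> = ennreal (card \<H> * (?b1 + ?b2))"
    by (simp only: ennreal_of_nat_eq_real_of_nat) (simp add: ennreal_mult)
  finally show "(\<Sum>H\<in>\<H>. \<integral>\<^sup>+A. emeasure (K A) (?X H) \<partial>W H) \<le> ennreal (card \<H> * (?b1 + ?b2))" .
qed auto

end

subsection \<open>The threshold\<close>

theorem corollary4:
  fixes \<H> :: "nat \<Rightarrow> graph set" and m :: "nat \<Rightarrow> nat"
    and P Q :: "nat \<Rightarrow> 'a measure"
  assumes "\<And>n. n \<ge> 1 \<Longrightarrow> \<H> n \<noteq> {}"
    and "\<And>n H. n \<ge> 1 \<Longrightarrow> H \<in> \<H> n \<Longrightarrow> H \<subseteq> complete_edges n \<and> card H = m n"
    and "filterlim m at_top sequentially"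
    and "\<And>n. n \<ge> 1 \<Longrightarrow> prob_space (P n)"
    and "\<And>n. n \<ge> 1 \<Longrightarrow> prob_space (Q n)"
    and "\<And>n. n \<ge> 1 \<Longrightarrow> sets (P n) = sets (Q n)"
    and "\<And>n. n \<ge> 1 \<Longrightarrow> absolutely_continuous (Q n) (P n)"
    and "uniformly_sparse \<H> m"
    and "renyi_stable P Q"
    and "\<exists>\<epsilon> :: nat \<Rightarrow> real. \<epsilon> \<longlonglongrightarrow> 0 \<and>
           (\<forall>\<^sub>F n in sequentially.
              renyi_div 2 (P n) (Q n) = ereal (1 + \<epsilon> n) * kl_div (P n) (Q n))"
  shows
    "((\<exists>\<eta>>0. \<forall>\<^sub>F n in sequentially.
          kl_div (P n) (Q n) \<ge> ereal ((1 + \<eta>) * ln (1 / p1M (\<H> n) (m n)))) \<longrightarrow>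
        (\<forall>K. (\<forall>n\<ge>1. is_MLE n (P n) (Q n) (\<H> n) (K n)) \<longrightarrow>
           almost_exact_recovery P Q \<H> m K)) \<and>
     ((\<exists>\<eta>>0. \<forall>\<^sub>F n in sequentially.
          kl_div (P n) (Q n) \<le> ereal ((1 - \<eta>) * ln (1 / p1M (\<H> n) (m n)))) \<longrightarrow>
        (\<forall>K. (\<forall>n\<ge>1. is_estimator n (Q n) (\<H> n) (K n)) \<longrightarrow>
           (\<forall>r :: real. 0 < r \<and> r < 1 \<longrightarrow>
              (\<lambda>n. measure (recovery_law n (P n) (Q n) (\<H> n) (K n))
                 {(Hstar, Hhat) \<in> \<H> n \<times> \<H> n.
                    real (card (Hhat \<inter> Hstar)) \<ge> r * real (m n)}) \<longlonglongrightarrow> 0)))"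
proof -
  define L where "L n = ln (1 / p1M (\<H> n) (m n))" for n
  define g where "g n = real_of_ereal (overlap_max (\<H> n) (m n))" for n
  have model: "hidden_graph n (m n) (\<H> n) (P n) (Q n)" if "n \<ge> 1" for n
    using assms(1,2,4-7)[of n] that unfolding hidden_graph_def by blast
  have ev1: "\<forall>\<^sub>F n in sequentially. n \<ge> 1 \<and> m n > 0"
    using filterlim_at_top[THEN iffD1, OF assms(3), rule_format, of 1] eventually_ge_at_top[of 1]
    by eventually_elim simp
  have ln_card: "ln (real (card (\<H> n))) = real (m n) * L n" if "n \<ge> 1" "m n > 0" for n
    using hidden_graph.card_H_eq[OF model[OF that(1)] that(2)] by (simp add: L_def)
  \<comment> \<open>The Landau hypothesis controls only \<open>norm (L n)\<close>; nonnegativity is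
    what makes \<open>L\<close> tend to plus infinity.\<close>
  have L_nonneg: "L n \<ge> 0" if "n \<ge> 1" "m n > 0" for n
  proof -
    have "card (\<H> n) > 0"
      using assms(1)[OF that(1)] hidden_graph.finite_H[OF model[OF that(1)]] by (simp add: card_gt_0_iff)
    then have "0 \<le> real (m n) * L n"
      by (simp add: ln_card[OF that, symmetric])
    then show ?thesis using that by (simp add: zero_le_mult_iff)
  qed
  have L_top: "filterlim L at_top sequentially"
    unfolding filterlim_at_top
  proof
    fix C :: real
    have "L \<in> \<omega>(\<lambda>_. 1)" using assms(8) unfolding uniformly_sparse_def L_def by blast
    then have "\<forall>\<^sub>F n in sequentially. norm (L n) \<ge> (\<bar>C\<bar> + 1) * norm (1 :: real)"
      by (rule landau_omega.smallD) simp
    with ev1 show "\<forall>\<^sub>F n in sequentially. C \<le> L n"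
      by eventually_elim (use L_nonneg in force)
  qed
  have g_small: "g \<in> o(\<lambda>n. real (m n) * L n)"
  proof -
    have "\<forall>\<^sub>F n in sequentially. ln (real (card (\<H> n))) = real (m n) * L n"
      using ev1 by eventually_elim (use ln_card in blast)
    moreover have "g \<in> o(\<lambda>n. ln (real (card (\<H> n))))"
      using assms(8) unfolding uniformly_sparse_def g_def by blast
    ultimately show ?thesis
      by (simp only: landau_o.small.cong)
  qed
  have ev: "\<forall>\<^sub>F n in sequentially. n \<ge> 1 \<and> m n > 0 \<and> L n > 0"
    using ev1 filterlim_at_top_dense[THEN iffD1, OF L_top, rule_format, of 0]
    by eventually_elim simp
  note small = sparse_term_tendsto_0[OF assms(3) L_top g_small]

  have part1: "almost_exact_recovery P Q \<H> m K"
    if \<eta>: "\<eta> > 0" and kl: "\<forall>\<^sub>F n in sequentially. kl_div (P n) (Q n) \<ge> ereal ((1 + \<eta>) * L n)"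
      and K: "\<forall>n\<ge>1. is_MLE n (P n) (Q n) (\<H> n) (K n)" for \<eta> K
  proof -
    \<comment> \<open>This \<open>\<theta>\<close> keeps the threshold
      \<open>t = (1 - \<theta>) * D\<close> above \<open>L\<close> by half of the margin
      \<open>\<eta>\<close>. Using stability with \<open>\<theta> / 2\<close> gives
      \<open>c = (1 - \<theta> / 2) * D\<close>, hence a gap
      \<open>c - t = \<theta> / 2 * D\<close>.\<close>
    define \<theta> where "\<theta> = \<eta> / (2 * (1 + \<eta>))"
    have \<theta>: "0 < \<theta>" "\<theta> < 1" "(1 - \<theta>) * (1 + \<eta>) = 1 + \<eta> / 2"
      using \<eta> by (auto simp: \<theta>_def field_simps)
    have "\<theta> / 2 > 0" using \<theta> by simp
    with assms(9) obtain \<alpha> :: "nat \<Rightarrow> real" where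
      \<alpha>: "\<And>n. 0 < \<alpha> n \<and> \<alpha> n < 1"
      and omega: "ereal_smallomega (\<lambda>n. ereal (1 - \<alpha> n)) (\<lambda>n. 1 / kl_div (P n) (Q n))"
      and renyi: "\<forall>\<^sub>F n in sequentially.
        renyi_div (\<alpha> n) (P n) (Q n) \<ge> ereal (1 - \<theta> / 2) * kl_div (P n) (Q n)"
      unfolding renyi_stable_def by blast
    define D where "D n = real_of_ereal (kl_div (P n) (Q n))" for n
    define a where "a n = 1 - \<alpha> n" for n
    have a: "a n > 0" for n using \<alpha>[of n] by (simp add: a_def)
    have D: "\<forall>\<^sub>F n in sequentially. n \<ge> 1 \<and> m n > 0 \<and> L n > 0 \<and>
        kl_div (P n) (Q n) = ereal (D n) \<and> (1 + \<eta>) * L n \<le> D n \<and>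
        ereal ((1 - \<theta> / 2) * D n) \<le> renyi_div (1 - a n) (P n) (Q n)"
      using ev kl renyi
    proof eventually_elim
      case (elim n)
      \<comment> \<open>Stability bounds this divergence from below by a positive multiple of the KL
        divergence, so finiteness carries over to the latter.\<close>
      have "renyi_div (1 - a n) (P n) (Q n) \<noteq> \<infinity>"
        using elim(1) by (intro hidden_graph.renyi_div_less_1_finite[OF model] a) auto
      then have "kl_div (P n) (Q n) \<noteq> \<infinity>"
        using elim(3) \<theta> by (auto simp: a_def)
      moreover have "kl_div (P n) (Q n) \<noteq> -\<infinity>" using elim(2) by auto
      ultimately have "kl_div (P n) (Q n) = ereal (D n)"
        unfolding D_def by (cases "kl_div (P n) (Q n)") auto
      with elim show ?case by (simp add: a_def)
    qed
    have aD: "\<forall>\<^sub>F n in sequentially. a n * D n \<ge> C" if "C > 0" for C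
    proof -
      have "\<forall>\<^sub>F n in sequentially. \<bar>ereal (1 - \<alpha> n)\<bar> \<ge> ereal C * \<bar>1 / kl_div (P n) (Q n)\<bar>"
        using omega that unfolding ereal_smallomega_def by blast
      with D show ?thesis
      proof eventually_elim
        case (elim n)
        then have "D n > 0" using \<eta> by (smt (verit) mult_pos_pos)
        with elim show ?case using a[of n] by (auto simp: a_def one_ereal_def field_simps)
      qed
    qed
    define X where "X \<delta> n = measure (recovery_law n (P n) (Q n) (\<H> n) (K n))
      {(Hstar, Hhat) \<in> \<H> n \<times> \<H> n. real (card (Hhat \<inter> Hstar)) < (1 - \<delta>) * real (m n)}" for \<delta> n
    have X: "X \<delta> \<longlonglongrightarrow> 0" if \<delta>: "\<delta> > 0" for \<delta>
    proof -
      \<comment> \<open>Once \<open>a * D\<close> exceeds this constant, each edge gains a factor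
        \<open>1 / 4\<close>, which beats the \<open>2 ^ m\<close> subsets and leaves
        \<open>(1 / 2) ^ m\<close>.\<close>
      have "ln 4 / (\<theta> / 2 * \<delta>) > 0" using \<theta> \<delta> by simp
      note aD' = aD[OF this]
      have "\<forall>\<^sub>F n in sequentially. norm (X \<delta> n) \<le> (1 / 2) ^ m n
        + (real (m n) + 1) * exp (g n - \<eta> / 2 * \<delta> * L n * real (m n))"
        using D aD'
      proof eventually_elim
        case (elim n)
        have D0: "D n > 0" using elim \<eta> by (smt (verit) mult_pos_pos)
        have "(1 - \<theta>) * ((1 + \<eta>) * L n) \<le> (1 - \<theta>) * D n"
          using elim \<theta> by (intro mult_left_mono) auto
        then have t: "(1 + \<eta> / 2) * L n \<le> (1 - \<theta>) * D n"
          by (simp add: \<theta>(3) flip: mult.assoc)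
        have t1: "L n \<le> (1 - \<theta>) * D n"
          by (rule order_trans[OF _ t]) (use elim \<eta> in \<open>simp add: algebra_simps\<close>)
        have t2: "(1 - \<theta>) * D n \<le> (1 - \<theta> / 2) * D n"
          using D0 \<theta> by (intro mult_right_mono) auto
        have "X \<delta> n \<le> 2 ^ m n * exp (- (a n * ((1 - \<theta> / 2) * D n - (1 - \<theta>) * D n) * (\<delta> * real (m n))))
            + (real (m n) + 1) * exp (g n - ((1 - \<theta>) * D n - L n) * (\<delta> * real (m n)))"
          using elim K \<delta> a t1 t2 unfolding X_def g_def L_def
          by (intro hidden_graph.MLE_overlap_bound[OF model]) auto
        also have "2 ^ m n * exp (- (a n * ((1 - \<theta> / 2) * D n - (1 - \<theta>) * D n) * (\<delta> * real (m n))))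
            = (2 * exp (- (a n * D n * (\<theta> / 2 * \<delta>)))) ^ m n"
          by (simp add: power_mult_distrib exp_of_nat_mult[symmetric] algebra_simps)
        also have "\<dots> \<le> (1 / 2) ^ m n"
        proof (rule power_mono)
          have "ln 4 \<le> a n * D n * (\<theta> / 2 * \<delta>)"
            using elim(2) \<theta> \<delta> by (simp add: field_simps)
          then have "exp (- (a n * D n * (\<theta> / 2 * \<delta>))) \<le> exp (- ln 4)" by simp
          then show "2 * exp (- (a n * D n * (\<theta> / 2 * \<delta>))) \<le> 1 / 2"
            by (simp add: exp_minus)
        qed simp
        also have "exp (g n - ((1 - \<theta>) * D n - L n) * (\<delta> * real (m n)))
            \<le> exp (g n - \<eta> / 2 * \<delta> * L n * real (m n))"
        proof -
          have "(\<eta> / 2 * L n) * (\<delta> * real (m n)) \<le> ((1 - \<theta>) * D n - L n) * (\<delta> * real (m n))"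
            using t \<delta> by (intro mult_right_mono) (auto simp: algebra_simps)
          then show ?thesis by (simp add: algebra_simps)
        qed
        finally show ?case by (simp add: X_def mult_left_mono)
      qed
      moreover have "(\<lambda>n. (1 / 2 :: real) ^ m n
          + (real (m n) + 1) * exp (g n - \<eta> / 2 * \<delta> * L n * real (m n))) \<longlonglongrightarrow> 0 + 0"
        using \<eta> \<delta> by (intro tendsto_add small filterlim_compose[OF LIMSEQ_power_zero assms(3)]) auto
      ultimately show ?thesis
        by (simp add: Lim_null_comparison)
    qed
    \<comment> \<open>From here on, the fixed tolerances are diagonalised into a vanishing
      one.\<close>
    have "X (1 / (real k + 1)) \<longlonglongrightarrow> 0" for k
      by (rule X) simp
    then have "\<exists>\<kappa> :: nat \<Rightarrow> nat. filterlim \<kappa> at_top sequentially \<and>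
        (\<lambda>n. X (1 / (real (\<kappa> n) + 1)) n) \<longlonglongrightarrow> 0"
      by (rule diagonal_tendsto_0[where X = "\<lambda>k. X (1 / (real k + 1))"])
    then obtain \<kappa> :: "nat \<Rightarrow> nat" where
      \<kappa>: "filterlim \<kappa> at_top sequentially" "(\<lambda>n. X (1 / (real (\<kappa> n) + 1)) n) \<longlonglongrightarrow> 0"
      by blast
    have "(\<lambda>n. 1 / (real (\<kappa> n) + 1)) \<longlonglongrightarrow> 0"
      using filterlim_compose[OF LIMSEQ_inverse_real_of_nat \<kappa>(1)]
      by (simp add: inverse_eq_divide add.commute)
    with \<kappa>(2) show ?thesis
      unfolding almost_exact_recovery_def X_def by blast
  qed

  have part2: "(\<lambda>n. measure (recovery_law n (P n) (Q n) (\<H> n) (K n))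
      {(Hstar, Hhat) \<in> \<H> n \<times> \<H> n. real (card (Hhat \<inter> Hstar)) \<ge> r * real (m n)}) \<longlonglongrightarrow> 0"
      (is "?Y \<longlonglongrightarrow> 0")
    if \<eta>: "\<eta> > 0" and kl: "\<forall>\<^sub>F n in sequentially. kl_div (P n) (Q n) \<le> ereal ((1 - \<eta>) * L n)"
      and K: "\<forall>n\<ge>1. is_estimator n (Q n) (\<H> n) (K n)" and r: "0 < r" for \<eta> K r
  proof -
    from assms(10) obtain \<epsilon> :: "nat \<Rightarrow> real" where \<epsilon>: "\<epsilon> \<longlonglongrightarrow> 0"
      and renyi: "\<forall>\<^sub>F n in sequentially.
        renyi_div 2 (P n) (Q n) = ereal (1 + \<epsilon> n) * kl_div (P n) (Q n)"
      by blast
    have "(\<lambda>n. (1 + \<epsilon> n) * (1 - \<eta>)) \<longlonglongrightarrow> (1 + 0) * (1 - \<eta>)"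
      by (intro tendsto_intros \<epsilon>)
    then have "\<forall>\<^sub>F n in sequentially. (1 + \<epsilon> n) * (1 - \<eta>) < 1 - \<eta> / 2"
      by (rule order_tendstoD) (use \<eta> in simp)
    \<comment> \<open>This makes the factor \<open>1 + \<epsilon> n\<close> positive, so multiplying
      the bound on the KL divergence by it preserves the inequality.\<close>
    moreover have "\<forall>\<^sub>F n in sequentially. -1 < \<epsilon> n"
      using \<epsilon> by (rule order_tendstoD) simp
    ultimately have D2: "\<forall>\<^sub>F n in sequentially. n \<ge> 1 \<and> m n > 0 \<and> L n > 0 \<and>
        renyi_div 2 (P n) (Q n) \<le> ereal ((1 - \<eta> / 2) * L n)"
      using ev kl renyi
    proof eventually_elim
      case (elim n)
      have "renyi_div 2 (P n) (Q n) \<le> ereal (1 + \<epsilon> n) * ereal ((1 - \<eta>) * L n)"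
        unfolding elim(5) using elim by (intro ereal_mult_left_mono) auto
      also have "\<dots> = ereal (((1 + \<epsilon> n) * (1 - \<eta>)) * L n)" by simp
      also have "\<dots> \<le> ereal ((1 - \<eta> / 2) * L n)"
        using elim by (intro ereal_less_eq(3)[THEN iffD2] mult_right_mono) auto
      finally show ?case using elim by simp
    qed
    define u where "u n = (real (m n) + 1) * exp (g n - \<eta> / 2 * (r\<^sup>2 / 2) * L n * real (m n))" for n
    have u: "u \<longlonglongrightarrow> 0" unfolding u_def using \<eta> r by (intro small) auto
    show ?thesis
    proof (rule tendstoI)
      fix e :: real assume e: "e > 0"
      \<comment> \<open>The bound is applied with \<open>c = e\<close>. Its first term is then
        \<open>e / 2\<close>, and this choice pushes the second,
        \<open>u n / (r\<^sup>2 * e)\<close>, below \<open>e / 2\<close>.\<close>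
      have "\<forall>\<^sub>F n in sequentially. u n < r\<^sup>2 * e * (e / 2)"
        using u by (rule order_tendstoD) (use r e in simp)
      with D2 show "\<forall>\<^sub>F n in sequentially. dist (?Y n) 0 < e"
      proof eventually_elim
        case (elim n)
        have "?Y n \<le> e / 2 + (real (m n) + 1) * exp (g n - (L n - (1 - \<eta> / 2) * L n) * (r\<^sup>2 / 2 * real (m n)))
            / (r\<^sup>2 * e)"
          using elim K r e \<eta> unfolding g_def L_def
          by (intro hidden_graph.estimator_overlap_bound[OF model]) (auto simp: algebra_simps)
        also have "(real (m n) + 1) * exp (g n - (L n - (1 - \<eta> / 2) * L n) * (r\<^sup>2 / 2 * real (m n))) = u n"
          by (simp add: u_def algebra_simps)
        also have "u n / (r\<^sup>2 * e) < e / 2"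
          using elim(2) r e by (simp add: field_simps)
        finally show ?case by simp
      qed
    qed
  qed

  show ?thesis
    using part1 part2 unfolding L_def by blast
qed

end
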